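(* Let $n\ge1$, $d\ge 2$, $R=\mathcal{O}_{\mathbb{P}^n}(1)$ and $L=\mathcal{O}_{\mathbb{P}^n}(d)$ on $\mathbb{P}^n$ over $\mathbb{C}$. (i) Let $m\ge1$ be an integer such that $(n-m)(m+1)<\binom{m+d}{m}$, and assume $d\ge4$. Then $\mathrm{s}^R(u)\ge n-m+1$ for a general $u\in H^0(L)$. (ii) Let $e$ be the maximal dimension of a linear subspace of $\mathbb{P}^n$ contained in a general degree $d$ hypersurface. Then $\mathrm{s}^R(u)\le n-e$ for all nonzero $u\in H^0(L)$, and equality holds for a general $u$.
   Context: For a nonzero homogeneous polynomial $u$ of degree $d$ in $n+1$ variables, the $R$-strength $\mathrm{s}^R(u)$ with $R=\mathcal{O}_{\mathbb{P}^n}(1)$ is the minimal $r$ such that $u=\sum_{i=1}^r\ell_ig_i$ with $\ell_i$ linear forms and $g_i$ homogeneous polynomials of degree $d-1$ ($+\infty$ if none exists). *)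

theory Defs
  imports "HOL-Analysis.Analysis" "HOL-Library.Poly_Mapping" "HOL-Library.Extended_Nat"
begin

text \<open>Multivariate polynomials over the complex numbers in variables indexed by a type 'v,
  represented as finitely supported maps from monomials (finitely supported exponent vectors)
  to coefficients; ring operations are those of Poly_Mapping (convolution product).
  The homogeneous coordinates of P^n are the variables 0..n.\<close>

type_synonym 'v cpoly = "('v \<Rightarrow>\<^sub>0 nat) \<Rightarrow>\<^sub>0 complex"

definition mon_deg :: "('v \<Rightarrow>\<^sub>0 nat) \<Rightarrow> nat" where
  "mon_deg \<alpha> = (\<Sum>i\<in>Poly_Mapping.keys \<alpha>. Poly_Mapping.lookup \<alpha> i)"

definition peval :: "'v cpoly \<Rightarrow> ('v \<Rightarrow> complex) \<Rightarrow> complex" where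
  "peval p x = (\<Sum>\<alpha>\<in>Poly_Mapping.keys p. Poly_Mapping.lookup p \<alpha> * (\<Prod>i\<in>Poly_Mapping.keys \<alpha>. x i ^ Poly_Mapping.lookup \<alpha> i))"

text \<open>Homogeneous polynomial of degree d in the n+1 variables x_0..x_n
  (the zero polynomial included), i.e. an element of H^0(O_{P^n}(d)).\<close>
definition hom_form :: "nat \<Rightarrow> nat \<Rightarrow> nat cpoly \<Rightarrow> bool" where
  "hom_form n d p \<longleftrightarrow> (\<forall>\<alpha>\<in>Poly_Mapping.keys p. Poly_Mapping.keys \<alpha> \<subseteq> {0..n} \<and> mon_deg \<alpha> = d)"

text \<open>R-strength with R = O(1): least r with u = sum_{i<r} l_i g_i, l_i linear forms,
  g_i forms of degree d-1; infinity if no such decomposition exists.\<close>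
definition R_strength :: "nat \<Rightarrow> nat \<Rightarrow> nat cpoly \<Rightarrow> enat" where
  "R_strength n d u = Inf {enat r | r. \<exists>l g. (\<forall>i<r. hom_form n 1 (l i) \<and> hom_form n (d - 1) (g i))
        \<and> u = (\<Sum>i<r. l i * g i)}"

text \<open>A property of degree-d forms holds for a general u: it holds on a nonempty
  Zariski open subset of the coefficient space H^0(O(d)); equivalently on a nonempty basic
  open set {u. F(u) \<noteq> 0}, F a polynomial in the coefficients of u.\<close>
definition general_form :: "nat \<Rightarrow> nat \<Rightarrow> (nat cpoly \<Rightarrow> bool) \<Rightarrow> bool" where
  "general_form n d P \<longleftrightarrow> (\<exists>F :: (nat \<Rightarrow>\<^sub>0 nat) cpoly.
      (\<exists>u. hom_form n d u \<and> peval F (Poly_Mapping.lookup u) \<noteq> 0) \<and>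
      (\<forall>u. hom_form n d u \<and> peval F (Poly_Mapping.lookup u) \<noteq> 0 \<longrightarrow> P u))"

text \<open>The hypersurface V(u) in P^n contains a projective linear subspace of dimension k:
  there are k+1 linearly independent vectors v_0..v_k in C^{n+1} (coordinates 0..n)
  whose span lies in the zero set of u.\<close>
definition contains_linear :: "nat \<Rightarrow> nat cpoly \<Rightarrow> nat \<Rightarrow> bool" where
  "contains_linear n u k \<longleftrightarrow> (\<exists>v :: nat \<Rightarrow> nat \<Rightarrow> complex.
      (\<forall>i\<le>k. \<forall>j>n. v i j = 0) \<and>
      (\<forall>c. (\<forall>j. (\<Sum>i\<le>k. c i * v i j) = 0) \<longrightarrow> (\<forall>i\<le>k. c i = 0)) \<and>
      (\<forall>c. peval u (\<lambda>j. \<Sum>i\<le>k. c i * v i j) = 0))"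

definition max_linear_dim :: "nat \<Rightarrow> nat cpoly \<Rightarrow> nat \<Rightarrow> bool" where
  "max_linear_dim n u k \<longleftrightarrow> contains_linear n u k \<and> (\<forall>k'>k. \<not> contains_linear n u k')"

end

theory Submission
  imports Defs
begin

text \<open>A form \<open>u\<close> has strength at most \<open>r\<close> iff its hypersurface contains a linear subspace of
  codimension \<open>r\<close>. Such a subspace is the graph of a linear map over a coordinate subspace, i.e. it
  has a basis \<open>w\<^sub>s\<close>, \<open>s \<in> S\<close>, with \<open>w\<^sub>s(t) = \<delta>\<^sub>s\<^sub>t\<close> for \<open>t \<in> S\<close>.

  For the lower bound, restricting \<open>u\<close> to this graph expresses the coefficients of the monomials in
  the variables \<open>S\<close> as polynomials in the remaining coefficients and the \<open>(n - m)(m + 1)\<close> entries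
  of the linear map. When these entries are fewer than the monomials of degree \<open>d\<close> in the
  variables \<open>S\<close>, a count of monomials yields an algebraic relation between the coefficients
  of \<open>u\<close>, so a general \<open>u\<close> contains no such subspace.

  For the second part, pivoting chooses \<open>S\<close> so that the entries of the \<open>w\<^sub>s\<close> are bounded;
  compactness then shows that containing a subspace of dimension \<open>e\<close> passes from general forms to
  all forms.\<close>

subsection \<open>Monomials and evaluation of polynomials\<close>

definition mon_eval :: "('v \<Rightarrow> complex) \<Rightarrow> ('v \<Rightarrow>\<^sub>0 nat) \<Rightarrow> complex" where
  "mon_eval x \<alpha> = (\<Prod>i\<in>Poly_Mapping.keys \<alpha>. x i ^ Poly_Mapping.lookup \<alpha> i)"

lemma mon_eval_superset:
  assumes "finite V" "Poly_Mapping.keys \<alpha> \<subseteq> V"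
  shows "mon_eval x \<alpha> = (\<Prod>i\<in>V. x i ^ Poly_Mapping.lookup \<alpha> i)"
  unfolding mon_eval_def
  by (rule prod.mono_neutral_left) (use assms in \<open>auto simp: in_keys_iff\<close>)

lemma mon_eval_0 [simp]: "mon_eval x 0 = 1"
  by (simp add: mon_eval_def)

lemma mon_eval_single [simp]: "mon_eval x (Poly_Mapping.single i k) = x i ^ k"
  by (simp add: mon_eval_def)

lemma mon_eval_add: "mon_eval x (\<alpha> + \<beta>) = mon_eval x \<alpha> * mon_eval x \<beta>"
proof -
  let ?V = "Poly_Mapping.keys \<alpha> \<union> Poly_Mapping.keys \<beta>"
  have "Poly_Mapping.keys (\<alpha> + \<beta>) \<subseteq> ?V" by (rule keys_add)
  then show ?thesis
    by (simp add: mon_eval_superset[of ?V] lookup_add power_add prod.distrib)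
qed

lemma mon_eval_cong:
  "(\<And>i. i \<in> Poly_Mapping.keys \<alpha> \<Longrightarrow> x i = y i) \<Longrightarrow> mon_eval x \<alpha> = mon_eval y \<alpha>"
  by (simp add: mon_eval_def)

lemma mon_deg_superset:
  assumes "finite V" "Poly_Mapping.keys \<alpha> \<subseteq> V"
  shows "mon_deg \<alpha> = (\<Sum>i\<in>V. Poly_Mapping.lookup \<alpha> i)"
  unfolding mon_deg_def
  by (rule sum.mono_neutral_left) (use assms in \<open>auto simp: in_keys_iff\<close>)

lemma mon_deg_0 [simp]: "mon_deg 0 = 0"
  by (simp add: mon_deg_def)

lemma mon_deg_single [simp]: "mon_deg (Poly_Mapping.single i k) = k"
  by (simp add: mon_deg_def)

lemma mon_deg_add: "mon_deg (\<alpha> + \<beta>) = mon_deg \<alpha> + mon_deg \<beta>"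
proof -
  let ?V = "Poly_Mapping.keys \<alpha> \<union> Poly_Mapping.keys \<beta>"
  have "Poly_Mapping.keys (\<alpha> + \<beta>) \<subseteq> ?V" by (rule keys_add)
  then show ?thesis
    by (simp add: mon_deg_superset[of ?V] lookup_add sum.distrib)
qed

lemma lookup_le_mon_deg: "Poly_Mapping.lookup \<alpha> i \<le> mon_deg \<alpha>"
proof (cases "i \<in> Poly_Mapping.keys \<alpha>")
  case True
  then show ?thesis unfolding mon_deg_def by (intro member_le_sum) auto
qed (simp add: in_keys_iff)

lemma mon_deg_eq_0_iff [simp]: "mon_deg \<alpha> = 0 \<longleftrightarrow> \<alpha> = 0"
proof
  assume "mon_deg \<alpha> = 0"
  then have "Poly_Mapping.lookup \<alpha> i = 0" for i
    using lookup_le_mon_deg[of \<alpha> i] by simp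
  then show "\<alpha> = 0" by (intro poly_mapping_eqI) simp
qed simp

lemma mon_split:
  fixes \<alpha> :: "'v \<Rightarrow>\<^sub>0 nat"
  assumes "i \<in> Poly_Mapping.keys \<alpha>"
  obtains \<beta> where "\<alpha> = Poly_Mapping.single i 1 + \<beta>" "Poly_Mapping.keys \<beta> \<subseteq> Poly_Mapping.keys \<alpha>"
proof
  let ?\<beta> = "\<alpha> - Poly_Mapping.single i (1::nat)"
  show "\<alpha> = Poly_Mapping.single i 1 + ?\<beta>"
    using assms by (intro poly_mapping_eqI)
      (auto simp: lookup_add lookup_minus lookup_single when_def in_keys_iff)
  show "Poly_Mapping.keys ?\<beta> \<subseteq> Poly_Mapping.keys \<alpha>"
    by (auto simp: in_keys_iff lookup_minus)
qed

lemma poly_mapping_sum_single: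
  "p = (\<Sum>\<alpha>\<in>Poly_Mapping.keys p. Poly_Mapping.single \<alpha> (Poly_Mapping.lookup p \<alpha>))"
  by (rule poly_mapping_eqI)
     (auto simp: lookup_sum lookup_single when_def in_keys_iff)

lemma peval_superset:
  assumes "finite A" "Poly_Mapping.keys p \<subseteq> A"
  shows "peval p x = (\<Sum>\<alpha>\<in>A. Poly_Mapping.lookup p \<alpha> * mon_eval x \<alpha>)"
  unfolding peval_def mon_eval_def[symmetric]
  by (rule sum.mono_neutral_left) (use assms in \<open>auto simp: in_keys_iff\<close>)

lemma peval_cong:
  assumes "\<And>\<alpha> i. \<alpha> \<in> Poly_Mapping.keys p \<Longrightarrow> i \<in> Poly_Mapping.keys \<alpha> \<Longrightarrow> x i = y i"
  shows "peval p x = peval p y"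
  unfolding peval_def mon_eval_def[symmetric]
  using assms by (intro sum.cong refl arg_cong2[of _ _ _ _ "(*)"] mon_eval_cong) auto

lemma peval_0 [simp]: "peval 0 x = 0"
  by (simp add: peval_def)

lemma peval_single [simp]: "peval (Poly_Mapping.single \<alpha> c) x = c * mon_eval x \<alpha>"
  by (simp add: peval_def mon_eval_def)

lemma peval_1 [simp]: "peval 1 x = 1"
  using peval_single[of 0 1 x] by simp

lemma peval_add: "peval (p + q) x = peval p x + peval q x"
proof -
  let ?A = "Poly_Mapping.keys p \<union> Poly_Mapping.keys q"
  have "Poly_Mapping.keys (p + q) \<subseteq> ?A" by (rule keys_add)
  then show ?thesis
    by (simp add: peval_superset[of ?A] lookup_add sum.distrib distrib_right)
qed

lemma peval_diff: "peval (p - q) x = peval p x - peval q x"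
  using peval_add[of "p - q" q x] by simp

lemma peval_uminus: "peval (- p) x = - peval p x"
  using peval_diff[of 0 p x] by simp

lemma peval_sum: "peval (sum f I) x = (\<Sum>i\<in>I. peval (f i) x)"
  by (induction I rule: infinite_finite_induct) (auto simp: peval_add)

lemma peval_mult: "peval (p * q) x = peval p x * peval q x"
proof -
  have "peval (p * q) x = peval ((\<Sum>\<alpha>\<in>Poly_Mapping.keys p. Poly_Mapping.single \<alpha> (Poly_Mapping.lookup p \<alpha>)) *
      (\<Sum>\<alpha>\<in>Poly_Mapping.keys q. Poly_Mapping.single \<alpha> (Poly_Mapping.lookup q \<alpha>))) x"
    by (simp flip: poly_mapping_sum_single)
  also have "\<dots> = (\<Sum>\<alpha>\<in>Poly_Mapping.keys p. \<Sum>\<beta>\<in>Poly_Mapping.keys q.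
      Poly_Mapping.lookup p \<alpha> * mon_eval x \<alpha> * (Poly_Mapping.lookup q \<beta> * mon_eval x \<beta>))"
    by (simp add: sum_product peval_sum mult_single mon_eval_add mult_ac)
  also have "\<dots> = peval p x * peval q x"
    by (simp add: sum_product peval_def mon_eval_def)
  finally show ?thesis .
qed

lemma peval_power: "peval (p ^ k) x = peval p x ^ k"
  by (induction k) (auto simp: peval_mult)

lemma peval_prod: "peval (prod f I) x = (\<Prod>i\<in>I. peval (f i) x)"
  by (induction I rule: infinite_finite_induct) (auto simp: peval_mult)

text \<open>Induction on the variables: collecting terms by the exponent of one variable gives a
  one-variable polynomial, some coefficient of which is nonzero at a suitable point by induction, so
  it has finitely many roots. Exponents are plain functions, so passing to a smaller
  \<open>V\<close> truncates nothing; the last hypothesis says that \<open>V\<close> still separates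
  \<open>E\<close>.\<close>

lemma mon_combination_nonvanishing:
  fixes c :: "('v \<Rightarrow> nat) \<Rightarrow> complex"
  assumes "finite V" "finite E" "e0 \<in> E" "c e0 \<noteq> 0"
    and "\<And>e e'. e \<in> E \<Longrightarrow> e' \<in> E \<Longrightarrow> (\<And>i. i \<in> V \<Longrightarrow> e i = e' i) \<Longrightarrow> e = e'"
  shows "\<exists>x. (\<Sum>e\<in>E. c e * (\<Prod>i\<in>V. x i ^ e i)) \<noteq> 0"
  using assms
proof (induction V arbitrary: E e0 rule: finite_induct)
  case empty
  then have "E = {e0}" by auto
  with empty show ?case by auto
next
  case (insert v V)
  define G where "G k = {e\<in>E. e v = k}" for k
  have "\<exists>x. (\<Sum>e\<in>G (e0 v). c e * (\<Prod>i\<in>V. x i ^ e i)) \<noteq> 0"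
  proof (rule insert.IH)
    fix e e' assume "e \<in> G (e0 v)" "e' \<in> G (e0 v)" "\<And>i. i \<in> V \<Longrightarrow> e i = e' i"
    moreover from this have "e i = e' i" if "i \<in> insert v V" for i
      using that by (auto simp: G_def)
    ultimately show "e = e'" by (intro insert.prems(4)) (auto simp: G_def)
  qed (use insert.prems in \<open>auto simp: G_def\<close>)
  then obtain x where x: "(\<Sum>e\<in>G (e0 v). c e * (\<Prod>i\<in>V. x i ^ e i)) \<noteq> 0" by blast
  define K where "K = (\<lambda>e. e v) ` E"
  have finK: "finite K" using insert.prems by (simp add: K_def)
  \<comment> \<open>The combination as a polynomial in the value of \<open>v\<close>, the variables
    in \<open>V\<close> being fixed at \<open>x\<close>.\<close>
  define P where "P = (\<Sum>k\<in>K. monom (\<Sum>e\<in>G k. c e * (\<Prod>i\<in>V. x i ^ e i)) k)"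
  have "coeff P (e0 v) = (\<Sum>e\<in>G (e0 v). c e * (\<Prod>i\<in>V. x i ^ e i))"
    using finK insert.prems by (auto simp: P_def coeff_sum K_def)
  with x have "P \<noteq> 0" by auto
  then have "finite {t. poly P t = 0}" by (rule poly_roots_finite)
  then obtain t where t: "poly P t \<noteq> 0"
    using ex_new_if_finite[OF infinite_UNIV_char_0] by blast
  let ?y = "x(v := t)"
  have eqV: "(\<Prod>i\<in>V. ?y i ^ e i) = (\<Prod>i\<in>V. x i ^ e i)" for e
    using insert.hyps by (intro prod.cong) auto
  have "(\<Sum>e\<in>E. c e * (\<Prod>i\<in>insert v V. ?y i ^ e i)) =
        (\<Sum>e\<in>E. c e * (\<Prod>i\<in>V. x i ^ e i) * t ^ e v)"
    using insert.hyps by (simp add: eqV del: fun_upd_apply) (simp add: mult_ac)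
  also have "\<dots> = (\<Sum>k\<in>K. \<Sum>e\<in>G k. c e * (\<Prod>i\<in>V. x i ^ e i) * t ^ e v)"
    unfolding G_def K_def using insert.prems by (intro sum.image_gen)
  also have "\<dots> = (\<Sum>k\<in>K. \<Sum>e\<in>G k. c e * (\<Prod>i\<in>V. x i ^ e i) * t ^ k)"
    by (intro sum.cong) (auto simp: G_def)
  also have "\<dots> = poly P t"
    by (simp add: P_def poly_sum poly_monom sum_distrib_right)
  finally show ?case using t by metis
qed

lemma peval_nonvanishing:
  assumes "p \<noteq> 0"
  shows "\<exists>x. peval p x \<noteq> 0"
proof -
  define V where "V = (\<Union>\<alpha>\<in>Poly_Mapping.keys p. Poly_Mapping.keys \<alpha>)"
  have finV: "finite V" by (simp add: V_def)
  define E where "E = Poly_Mapping.lookup ` Poly_Mapping.keys p"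
  obtain \<alpha>0 where \<alpha>0: "\<alpha>0 \<in> Poly_Mapping.keys p" using assms keys_eq_empty[of p] by blast
  have inj: "inj_on Poly_Mapping.lookup (Poly_Mapping.keys p)"
    by (auto simp: inj_on_def intro: poly_mapping_eqI)
  \<comment> \<open>The coefficient must be a function of the bare exponent function
    \<open>e\<close>, so the monomial is recovered by \<open>Abs_poly_mapping\<close>.\<close>
  define c where "c e = Poly_Mapping.lookup p (Abs_poly_mapping e)" for e
  have c: "c (Poly_Mapping.lookup \<alpha>) = Poly_Mapping.lookup p \<alpha>" for \<alpha>
    by (simp add: c_def Poly_Mapping.poly_mapping.lookup_inverse)
  have "\<exists>x. (\<Sum>e\<in>E. c e * (\<Prod>i\<in>V. x i ^ e i)) \<noteq> 0"
  proof (rule mon_combination_nonvanishing[OF finV])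
    show "Poly_Mapping.lookup \<alpha>0 \<in> E" "c (Poly_Mapping.lookup \<alpha>0) \<noteq> 0"
      using \<alpha>0 by (auto simp: E_def c in_keys_iff)
    fix e e' assume "e \<in> E" "e' \<in> E" and eq: "\<And>i. i \<in> V \<Longrightarrow> e i = e' i"
    then obtain \<alpha> \<beta> where *: "\<alpha> \<in> Poly_Mapping.keys p" "\<beta> \<in> Poly_Mapping.keys p"
      "e = Poly_Mapping.lookup \<alpha>" "e' = Poly_Mapping.lookup \<beta>" by (auto simp: E_def)
    then have "i \<notin> V \<Longrightarrow> e i = e' i" for i by (auto simp: V_def in_keys_iff)
    with eq show "e = e'" by blast
  qed (simp add: E_def)
  then obtain x where x: "(\<Sum>e\<in>E. c e * (\<Prod>i\<in>V. x i ^ e i)) \<noteq> 0" by blast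
  have "peval p x = (\<Sum>\<alpha>\<in>Poly_Mapping.keys p. Poly_Mapping.lookup p \<alpha> * (\<Prod>i\<in>V. x i ^ Poly_Mapping.lookup \<alpha> i))"
    unfolding peval_def mon_eval_def[symmetric] using finV
    by (intro sum.cong refl arg_cong2[of _ _ _ _ "(*)"] mon_eval_superset) (auto simp: V_def)
  also have "\<dots> = (\<Sum>e\<in>E. c e * (\<Prod>i\<in>V. x i ^ e i))"
    by (simp add: E_def sum.reindex[OF inj] c)
  finally show ?thesis using x by metis
qed

text \<open>This lets polynomial identities be proved by computing with values.\<close>

lemma peval_inject:
  assumes "\<And>x. peval p x = peval q x"
  shows "p = q"
  using peval_nonvanishing[of "p - q"] assms by (auto simp: peval_diff)

section \<open>Counting monomials and bounding the support of products\<close>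

definition mons :: "'v set \<Rightarrow> nat \<Rightarrow> ('v \<Rightarrow>\<^sub>0 nat) set" where
  "mons V d = {\<alpha>. Poly_Mapping.keys \<alpha> \<subseteq> V \<and> mon_deg \<alpha> = d}"

text \<open>Bounding each exponent separately, rather than the total degree, makes the count an
  exact power; the bounds still add up under products.\<close>

definition bmons :: "'v set \<Rightarrow> nat \<Rightarrow> ('v \<Rightarrow>\<^sub>0 nat) set" where
  "bmons V D = {\<alpha>. Poly_Mapping.keys \<alpha> \<subseteq> V \<and> (\<forall>i. Poly_Mapping.lookup \<alpha> i \<le> D)}"

lemma mons_subset_bmons: "mons V d \<subseteq> bmons V d"
  using lookup_le_mon_deg by (force simp: mons_def bmons_def)

lemma bmons_mono: "D \<le> D' \<Longrightarrow> bmons V D \<subseteq> bmons V D'"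
  by (auto simp: bmons_def intro: order_trans)

lemma bij_betw_bmons:
  assumes "finite V"
  shows "bij_betw (\<lambda>\<alpha>. restrict (Poly_Mapping.lookup \<alpha>) V) (bmons V D) (PiE V (\<lambda>_. {..D}))"
proof (rule bij_betwI[where g = "\<lambda>f. Abs_poly_mapping (\<lambda>i. if i \<in> V then f i else 0)"])
  have fin: "finite {i. (if i \<in> V then f i else 0) \<noteq> (0::nat)}" for f
    by (rule finite_subset[OF _ assms]) auto
  show "(\<lambda>f. Abs_poly_mapping (\<lambda>i. if i \<in> V then f i else 0)) \<in> (PiE V (\<lambda>_. {..D})) \<rightarrow> bmons V D"
    by (auto simp: bmons_def in_keys_iff lookup_Abs_poly_mapping[OF fin] PiE_mem split: if_splits)
  show "(\<lambda>\<alpha>. restrict (Poly_Mapping.lookup \<alpha>) V) \<in> bmons V D \<rightarrow> (PiE V (\<lambda>_. {..D}))"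
    by (auto simp: bmons_def)
  show "Abs_poly_mapping (\<lambda>i. if i \<in> V then restrict (Poly_Mapping.lookup \<alpha>) V i else 0) = \<alpha>"
    if "\<alpha> \<in> bmons V D" for \<alpha>
    using that fin by (intro poly_mapping_eqI) (auto simp: bmons_def in_keys_iff)
  show "restrict (Poly_Mapping.lookup (Abs_poly_mapping (\<lambda>i. if i \<in> V then f i else 0))) V = f"
    if "f \<in> PiE V (\<lambda>_. {..D})" for f
    using that by (auto simp: fun_eq_iff lookup_Abs_poly_mapping[OF fin] PiE_def extensional_def)
qed

lemma finite_bmons: "finite V \<Longrightarrow> finite (bmons V D)"
  using bij_betw_finite[OF bij_betw_bmons, of V D] by (simp add: finite_PiE)

lemma card_bmons: "finite V \<Longrightarrow> card (bmons V D) = (D + 1) ^ card V"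
  using bij_betw_same_card[OF bij_betw_bmons, of V D] by (simp add: card_PiE)

lemma finite_mons: "finite V \<Longrightarrow> finite (mons V d)"
  using finite_subset[OF mons_subset_bmons finite_bmons] .

text \<open>Exponent vectors of degree \<open>d\<close> are multisets of size \<open>d\<close>,
  whose number is known.\<close>

lemma card_mons:
  assumes "finite V"
  shows "card (mons V d) = (card V + d - 1) choose d"
proof -
  have fin: "finite {i. count M i \<noteq> 0}" for M :: "'a multiset"
    using finite_set_mset[of M] unfolding set_mset_def by (simp only: neq0_conv)
  have fin': "finite {i. 0 < Poly_Mapping.lookup \<alpha> i}" for \<alpha> :: "'a \<Rightarrow>\<^sub>0 nat"
    using finite_lookup[of \<alpha>] by (simp only: neq0_conv)
  define F where "F M = Abs_poly_mapping (count M)" for M :: "'a multiset"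
  define G where "G \<alpha> = Abs_multiset (Poly_Mapping.lookup \<alpha>)" for \<alpha> :: "'a \<Rightarrow>\<^sub>0 nat"
  have lF: "Poly_Mapping.lookup (F M) = count M" for M
    unfolding F_def by (rule lookup_Abs_poly_mapping[OF fin])
  have cG: "count (G \<alpha>) = Poly_Mapping.lookup \<alpha>" for \<alpha>
    unfolding G_def by (rule count_Abs_multiset[OF fin'])
  have kF: "Poly_Mapping.keys (F M) = set_mset M" for M
    by (simp add: set_eq_iff in_keys_iff lF)
  have sG: "set_mset (G \<alpha>) = Poly_Mapping.keys \<alpha>" for \<alpha>
    by (simp add: set_eq_iff in_keys_iff cG flip: count_greater_zero_iff)
  have "bij_betw F {M. set_mset M \<subseteq> V \<and> size M = d} (mons V d)"
  proof (rule bij_betwI[where g = G])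
    show "F \<in> {M. set_mset M \<subseteq> V \<and> size M = d} \<rightarrow> mons V d"
      by (auto simp: mons_def mon_deg_def kF lF size_multiset_overloaded_eq)
    show "G \<in> mons V d \<rightarrow> {M. set_mset M \<subseteq> V \<and> size M = d}"
      by (auto simp: mons_def mon_deg_def sG cG size_multiset_overloaded_eq)
    show "G (F M) = M" for M by (rule multiset_eqI) (simp add: cG lF)
    show "F (G \<alpha>) = \<alpha>" for \<alpha> by (rule poly_mapping_eqI) (simp add: cG lF)
  qed
  from bij_betw_same_card[OF this] show ?thesis
    using card_multisets_of_size[OF assms, of d] by (simp add: multisets_of_size_def)
qed

lemma mons_add: "\<alpha> \<in> mons V d \<Longrightarrow> \<beta> \<in> mons V e \<Longrightarrow> \<alpha> + \<beta> \<in> mons V (d + e)"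
  using keys_add[of \<alpha> \<beta>] by (auto simp: mons_def mon_deg_add)

lemma bmons_add: "\<alpha> \<in> bmons V d \<Longrightarrow> \<beta> \<in> bmons V e \<Longrightarrow> \<alpha> + \<beta> \<in> bmons V (d + e)"
  using keys_add[of \<alpha> \<beta>] by (auto simp: bmons_def lookup_add intro!: add_mono)

lemma keys_mult_mons:
  assumes "Poly_Mapping.keys p \<subseteq> mons V d" "Poly_Mapping.keys q \<subseteq> mons V e"
  shows "Poly_Mapping.keys (p * q) \<subseteq> mons V (d + e)"
  using keys_mult[of p q] assms mons_add by blast

lemma keys_mult_bmons:
  assumes "Poly_Mapping.keys p \<subseteq> bmons V d" "Poly_Mapping.keys q \<subseteq> bmons V e"
  shows "Poly_Mapping.keys (p * q) \<subseteq> bmons V (d + e)"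
  using keys_mult[of p q] assms bmons_add by blast

lemma keys_power_bmons:
  assumes "Poly_Mapping.keys p \<subseteq> bmons V d"
  shows "Poly_Mapping.keys (p ^ k) \<subseteq> bmons V (k * d)"
proof (induction k)
  case (Suc k)
  then show ?case using keys_mult_bmons[OF assms Suc] by simp
qed (simp add: bmons_def)

lemma keys_prod_bmons:
  assumes "finite I" "\<And>i. i \<in> I \<Longrightarrow> Poly_Mapping.keys (p i) \<subseteq> bmons V d"
  shows "Poly_Mapping.keys (\<Prod>i\<in>I. p i) \<subseteq> bmons V (card I * d)"
  using assms
proof (induction I rule: finite_induct)
  case (insert i I)
  then show ?case using keys_mult_bmons[of "p i" V d "prod p I" "card I * d"] by simp
qed (simp add: bmons_def)

lemma keys_sum_subset:
  assumes "\<And>i. i \<in> I \<Longrightarrow> Poly_Mapping.keys (p i) \<subseteq> A"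
  shows "Poly_Mapping.keys (\<Sum>i\<in>I. p i) \<subseteq> A"
  using keys_sum[of p I] assms by blast

lemma hom_form_iff: "hom_form n d p \<longleftrightarrow> Poly_Mapping.keys p \<subseteq> mons {0..n} d"
  by (auto simp: hom_form_def mons_def)

subsection \<open>Linear subspaces as graphs over coordinate subspaces\<close>

text \<open>The index type is arbitrary because the same normal form also serves for coefficient
  vectors indexed by monomials, in \<open>algebraic_dependence\<close>.\<close>

definition chart :: "'i set \<Rightarrow> 'i set \<Rightarrow> ('i \<Rightarrow> 'i \<Rightarrow> complex) \<Rightarrow> bool" where
  "chart I S w \<longleftrightarrow> S \<subseteq> I \<and> (\<forall>s\<in>S. \<forall>t\<in>S. w s t = (if s = t then 1 else 0))
     \<and> (\<forall>s\<in>S. \<forall>i. i \<notin> I \<longrightarrow> w s i = 0)"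

definition vanishes_on_chart :: "'i cpoly \<Rightarrow> 'i set \<Rightarrow> ('i \<Rightarrow> 'i \<Rightarrow> complex) \<Rightarrow> bool" where
  "vanishes_on_chart u S w \<longleftrightarrow> (\<forall>y. peval u (\<lambda>j. \<Sum>s\<in>S. y s * w s j) = 0)"

lemma chart_combination:
  assumes "chart I S w" "finite S" "t \<in> S"
  shows "(\<Sum>s\<in>S. y s * w s t) = y t"
proof -
  have "(\<Sum>s\<in>S. y s * w s t) = (\<Sum>s\<in>S. if s = t then y s else 0)"
    using assms by (intro sum.cong) (auto simp: chart_def)
  with assms show ?thesis by simp
qed

text \<open>Each equation costs at most one basis vector: if it fails on some \<open>w t\<close>,
  multiples of \<open>w t\<close> are subtracted from the others and \<open>t\<close> is dropped; if
  it holds on all of them, any one may be dropped.\<close>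

lemma kernel_chart:
  fixes b :: "'j \<Rightarrow> 'i \<Rightarrow> complex"
  assumes "finite J" "finite I" "k + card J \<le> card I"
  shows "\<exists>S w. chart I S w \<and> card S = k \<and> (\<forall>j\<in>J. \<forall>s\<in>S. (\<Sum>i\<in>I. b j i * w s i) = 0)"
  using assms
proof (induction J arbitrary: k rule: finite_induct)
  case empty
  then obtain S where "S \<subseteq> I" "card S = k"
    using obtain_subset_with_card_n[of k I] by auto
  then show ?case
    by (intro exI[of _ S] exI[of _ "\<lambda>s t. if s = t then 1 else 0"]) (auto simp: chart_def)
next
  case (insert j J)
  \<comment> \<open>One vector more than required, to be spent on the equation
    \<open>j\<close>.\<close>
  then have "Suc k + card J \<le> card I" by simp
  from insert.IH[OF insert.prems(1) this] obtain S w where S: "chart I S w" "card S = Suc k"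
    "\<And>j s. j \<in> J \<Longrightarrow> s \<in> S \<Longrightarrow> (\<Sum>i\<in>I. b j i * w s i) = 0"
    by blast
  have "finite S" using S(2) card.infinite by fastforce
  define f where "f s = (\<Sum>i\<in>I. b j i * w s i)" for s
  show ?case
  proof (cases "\<forall>s\<in>S. f s = 0")
    case True
    obtain t where "t \<in> S" using S(2) by fastforce
    with \<open>finite S\<close> S True show ?thesis
      by (intro exI[of _ "S - {t}"] exI[of _ w]) (auto simp: chart_def f_def)
  next
    case False
    then obtain t where t: "t \<in> S" "f t \<noteq> 0" by auto
    \<comment> \<open>Since \<open>w t\<close> vanishes on \<open>S - {t}\<close>, the identity
      block there is unchanged.\<close>
    define w' where "w' s i = w s i - f s / f t * w t i" for s i
    have lin: "(\<Sum>i\<in>I. b j' i * w' s i) = (\<Sum>i\<in>I. b j' i * w s i) - f s / f t * (\<Sum>i\<in>I. b j' i * w t i)" for j' s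
      by (simp add: w'_def right_diff_distrib sum_subtractf sum_distrib_left mult_ac)
    have "(\<Sum>i\<in>I. b j' i * w' s i) = 0" if "j' \<in> insert j J" "s \<in> S - {t}" for j' s
      using that t S(3) by (auto simp: lin f_def[symmetric])
    moreover have "chart I (S - {t}) w'"
      using S(1) t by (auto simp: chart_def w'_def)
    ultimately show ?thesis
      using \<open>finite S\<close> S(2) t by (intro exI[of _ "S - {t}"] exI[of _ w']) auto
  qed
qed

text \<open>Gaussian elimination with complete pivoting; the choice of a pivot of maximal modulus
  gives the bound on the entries, which makes the charts range over a compact set.\<close>

lemma independent_imp_bounded_chart:
  fixes v :: "nat \<Rightarrow> 'i \<Rightarrow> complex"
  assumes "finite I" "\<And>i j. i < k \<Longrightarrow> j \<notin> I \<Longrightarrow> v i j = 0"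
    and "\<And>c. (\<And>j. (\<Sum>i<k. c i * v i j) = 0) \<Longrightarrow> \<forall>i<k. c i = 0"
  shows "\<exists>S w C. chart I S w \<and> card S = k \<and> (\<forall>s\<in>S. \<forall>j. norm (w s j) \<le> 2 ^ k) \<and>
            (\<forall>s\<in>S. \<forall>j. w s j = (\<Sum>i<k. C s i * v i j))"
  using assms
proof (induction k)
  case 0
  show ?case by (intro exI[of _ "{}"]) (auto simp: chart_def)
next
  case (Suc k)
  have "\<exists>S w C. chart I S w \<and> card S = k \<and> (\<forall>s\<in>S. \<forall>j. norm (w s j) \<le> 2 ^ k) \<and>
            (\<forall>s\<in>S. \<forall>j. w s j = (\<Sum>i<k. C s i * v i j))"
  proof (rule Suc.IH)
    fix c assume "\<And>j. (\<Sum>i<k. c i * v i j) = 0"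
    \<comment> \<open>A relation among the first \<open>k\<close> vectors extends to all of them
      with coefficient 0 at \<open>k\<close>.\<close>
    then show "\<forall>i<k. c i = 0"
      using Suc.prems(3)[of "c(k := 0)"] by (auto dest: less_SucI)
  qed (use Suc.prems in auto)
  then obtain S w C where S: "chart I S w" "card S = k"
    "\<And>s j. s \<in> S \<Longrightarrow> norm (w s j) \<le> 2 ^ k"
    "\<And>s j. s \<in> S \<Longrightarrow> w s j = (\<Sum>i<k. C s i * v i j)" by blast
  have finS: "finite S" using S(1) Suc.prems(1) by (auto simp: chart_def intro: finite_subset)
  \<comment> \<open>The new vector minus the combination of old rows agreeing with it on
    \<open>S\<close>; hence \<open>x\<close> vanishes on \<open>S\<close>. By independence it is
    nonzero, as \<open>v k\<close> enters it with coefficient 1.\<close>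
  define x where "x j = v k j - (\<Sum>s\<in>S. v k s * w s j)" for j
  define cx where "cx i = (if i = k then 1 else - (\<Sum>s\<in>S. v k s * C s i))" for i
  have x: "x j = (\<Sum>i<Suc k. cx i * v i j)" for j
  proof -
    have "(\<Sum>s\<in>S. v k s * w s j) = (\<Sum>s\<in>S. v k s * (\<Sum>i<k. C s i * v i j))"
      using S(4) by (intro sum.cong) auto
    also have "\<dots> = (\<Sum>i<k. (\<Sum>s\<in>S. v k s * C s i) * v i j)"
      by (simp add: sum_distrib_left sum_distrib_right mult_ac sum.swap[of _ S])
    finally show ?thesis by (simp add: x_def cx_def sum_negf)
  qed
  have xI: "x j = 0" if "j \<notin> I" for j
    using that Suc.prems(2)[of k] S(1) by (simp add: x_def chart_def)
  have "\<exists>j. x j \<noteq> 0"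
  proof (rule ccontr)
    assume "\<nexists>j. x j \<noteq> 0"
    then have "\<forall>i<Suc k. cx i = 0" by (intro Suc.prems(3)) (simp del: sum.lessThan_Suc flip: x)
    then show False by (auto simp: cx_def)
  qed
  then obtain j0 where j0: "x j0 \<noteq> 0" "j0 \<in> I" using xI by blast
  have "Max ((\<lambda>j. norm (x j)) ` I) \<in> (\<lambda>j. norm (x j)) ` I"
    using Suc.prems(1) j0(2) by (intro Max_in) auto
  then obtain t where "t \<in> I" and t: "norm (x t) = Max ((\<lambda>j. norm (x j)) ` I)" by auto
  then have max: "\<And>j. j \<in> I \<Longrightarrow> norm (x j) \<le> norm (x t)"
    using Suc.prems(1) by simp
  have xt: "x t \<noteq> 0" using max[OF j0(2)] j0(1) by auto
  have xS: "x s = 0" if "s \<in> S" for s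
    using chart_combination[OF S(1) finS that] by (simp add: x_def)
  have tS: "t \<notin> S" using xt xS by auto
  define y where "y j = x j / x t" for j
  have y1: "norm (y j) \<le> 1" for j
    using max[of j] xI[of j] xt by (cases "j \<in> I") (auto simp: y_def norm_divide divide_simps)
  \<comment> \<open>Column \<open>t\<close> is cleared from the old rows and the normalised row
    \<open>y\<close> is added. As all entries of \<open>y\<close> have modulus at most 1, the bound
    on the entries at most doubles.\<close>
  define w' where "w' s j = (if s = t then y j else w s j - w s t * y j)" for s j
  \<comment> \<open>Tracking the coefficients over the original vectors keeps the new rows inside
    their span.\<close>
  define C' where "C' s i = (if s = t then cx i / x t else (if i < k then C s i else 0) - w s t * (cx i / x t))" for s i
  have "chart I (insert t S) w'"
    using S(1) tS xS xt \<open>t \<in> I\<close> xI by (auto simp: chart_def w'_def y_def)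
  moreover have "card (insert t S) = Suc k" using finS tS S(2) by simp
  moreover have "norm (w' s j) \<le> 2 ^ Suc k" if "s \<in> insert t S" for s j
  proof (cases "s = t")
    case True
    have "(1::real) \<le> 2 ^ Suc k" by (rule one_le_power) simp
    then show ?thesis using True y1[of j] by (simp add: w'_def)
  next
    case False
    then have "s \<in> S" using that by simp
    have "norm (w' s j) \<le> norm (w s j) + norm (w s t) * norm (y j)"
      using False norm_triangle_ineq4[of "w s j" "w s t * y j"] by (simp add: w'_def norm_mult)
    also have "\<dots> \<le> 2 ^ k + 2 ^ k * 1"
      using S(3)[OF \<open>s \<in> S\<close>] y1 by (intro add_mono mult_mono) auto
    finally show ?thesis by simp
  qed
  moreover have "w' s j = (\<Sum>i<Suc k. C' s i * v i j)" if "s \<in> insert t S" for s j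
  proof -
    have yj: "y j = (\<Sum>i<Suc k. cx i / x t * v i j)"
      by (simp add: y_def x sum_divide_distrib add_divide_distrib del: sum.lessThan_Suc)
    show ?thesis
    proof (cases "s = t")
      case True
      then show ?thesis using yj by (simp add: w'_def C'_def)
    next
      case False
      then have "s \<in> S" using that by simp
      have "(\<Sum>i<Suc k. C' s i * v i j) = (\<Sum>i<Suc k. (if i < k then C s i else 0) * v i j)
              - w s t * (\<Sum>i<Suc k. cx i / x t * v i j)"
        using False by (simp add: C'_def left_diff_distrib sum_subtractf sum_distrib_left mult.assoc
            del: sum.lessThan_Suc)
      also have "(\<Sum>i<Suc k. (if i < k then C s i else 0) * v i j) = w s j"
        using S(4)[OF \<open>s \<in> S\<close>] by simp
      finally show ?thesis using False by (simp add: w'_def yj del: sum.lessThan_Suc)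
    qed
  qed
  ultimately show ?case by blast
qed

text \<open>Every combination of chart rows is a combination of the given basis, so \<open>u\<close>
  vanishes on it. The bound on the entries is independent of \<open>u\<close>, as the later limit
  argument requires.\<close>

lemma contains_linear_imp_chart:
  assumes "contains_linear n u k"
  shows "\<exists>S w. chart {0..n} S w \<and> card S = Suc k \<and> (\<forall>s\<in>S. \<forall>j. norm (w s j) \<le> 2 ^ Suc k)
            \<and> vanishes_on_chart u S w"
proof -
  from assms obtain v where v: "\<forall>i\<le>k. \<forall>j>n. v i j = 0"
    "\<forall>c. (\<forall>j. (\<Sum>i\<le>k. c i * v i j) = 0) \<longrightarrow> (\<forall>i\<le>k. c i = 0)"
    "\<forall>c. peval u (\<lambda>j. \<Sum>i\<le>k. c i * v i j) = 0"
    unfolding contains_linear_def by blast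
  have "\<exists>S w C. chart {0..n} S w \<and> card S = Suc k \<and> (\<forall>s\<in>S. \<forall>j. norm (w s j) \<le> 2 ^ Suc k) \<and>
            (\<forall>s\<in>S. \<forall>j. w s j = (\<Sum>i<Suc k. C s i * v i j))"
    by (rule independent_imp_bounded_chart)
       (use v(1,2) in \<open>auto simp: lessThan_Suc_atMost less_Suc_eq_le\<close>)
  then obtain S w C where S: "chart {0..n} S w" "card S = Suc k"
    "\<forall>s\<in>S. \<forall>j. norm (w s j) \<le> 2 ^ Suc k"
    "\<And>s j. s \<in> S \<Longrightarrow> w s j = (\<Sum>i\<le>k. C s i * v i j)"
    unfolding lessThan_Suc_atMost by blast
  have "peval u (\<lambda>j. \<Sum>s\<in>S. y s * w s j) = 0" for y
  proof -
    have "(\<Sum>s\<in>S. y s * w s j) = (\<Sum>i\<le>k. (\<Sum>s\<in>S. y s * C s i) * v i j)" for j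
      using S(4) by (simp add: sum_distrib_left sum_distrib_right mult_ac sum.swap[of _ S])
    then show ?thesis using v(3) by simp
  qed
  with S show ?thesis unfolding vanishes_on_chart_def by blast
qed

text \<open>The rows are independent because each coefficient can be read off as a coordinate in
  \<open>S\<close>.\<close>

lemma chart_imp_contains_linear:
  assumes "chart {0..n} S w" "card S = Suc k" "vanishes_on_chart u S w"
  shows "contains_linear n u k"
proof -
  have finS: "finite S" using assms(2) card.infinite by fastforce
  then obtain f where f: "bij_betw f {..k} S"
    using finite_same_card_bij[of "{..k}" S] assms(2) by auto
  have fS: "f i \<in> S" if "i \<le> k" for i using f that by (auto simp: bij_betw_def)
  have sum_eq: "(\<Sum>i\<le>k. c i * w (f i) j) = (\<Sum>s\<in>S. c (inv_into {..k} f s) * w s j)" for c j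
    using sum.reindex_bij_betw[OF f, of "\<lambda>s. c (inv_into {..k} f s) * w s j"] f
    by (simp add: bij_betw_def)
  show ?thesis
    unfolding contains_linear_def
  proof (intro exI[of _ "\<lambda>i. w (f i)"] conjI allI impI)
    fix i j assume "i \<le> k" "n < j"
    then show "w (f i) j = 0" using assms(1) fS[of i] by (auto simp: chart_def)
  next
    fix c i assume c: "\<forall>j. (\<Sum>i\<le>k. c i * w (f i) j) = 0" and i: "i \<le> k"
    have "c i = c (inv_into {..k} f (f i))"
      using f i by (simp add: bij_betw_def)
    also have "\<dots> = 0"
      using chart_combination[OF assms(1) finS fS[OF i], of "\<lambda>s. c (inv_into {..k} f s)"] c
      by (simp flip: sum_eq)
    finally show "c i = 0" .
  next
    fix c show "peval u (\<lambda>j. \<Sum>i\<le>k. c i * w (f i) j) = 0"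
      using assms(3) by (simp add: sum_eq vanishes_on_chart_def)
  qed
qed

section \<open>Linear factors and linear subspaces\<close>

lemma mons_1: "mons V 1 = (\<lambda>i. Poly_Mapping.single i 1) ` V"
proof
  show "mons V 1 \<subseteq> (\<lambda>i. Poly_Mapping.single i 1) ` V"
  proof
    fix \<alpha> assume \<alpha>: "\<alpha> \<in> mons V 1"
    then have "\<alpha> \<noteq> 0" by (auto simp: mons_def)
    then obtain i where i: "i \<in> Poly_Mapping.keys \<alpha>"
      by (metis in_keys_iff lookup_zero poly_mapping_eqI)
    then obtain \<beta> where "\<alpha> = Poly_Mapping.single i 1 + \<beta>" by (rule mon_split)
    moreover from this have "\<beta> = 0" using \<alpha> by (simp add: mons_def mon_deg_add)
    ultimately show "\<alpha> \<in> (\<lambda>i. Poly_Mapping.single i 1) ` V" using i \<alpha> by (auto simp: mons_def)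
  qed
qed (auto simp: mons_def)

lemma peval_linear:
  assumes "finite V" "Poly_Mapping.keys l \<subseteq> mons V 1"
  shows "peval l x = (\<Sum>i\<in>V. Poly_Mapping.lookup l (Poly_Mapping.single i 1) * x i)"
proof -
  have inj: "inj_on (\<lambda>i. Poly_Mapping.single i (1::nat)) V"
    by (rule inj_onI) (metis keys_single singleton_inject zero_neq_one)
  show ?thesis
    unfolding peval_superset[OF finite_mons[OF assms(1)] assms(2)] mons_1 sum.reindex[OF inj]
    by simp
qed

text \<open>The common kernel of \<open>r\<close> linear forms in \<open>n + 1\<close> variables has
  dimension at least \<open>n + 1 - r\<close>, and every summand of \<open>u\<close> vanishes on
  it.\<close>

lemma decomposition_imp_chart:
  assumes "\<And>i. i < r \<Longrightarrow> hom_form n 1 (l i)" and u: "u = (\<Sum>i<r. l i * g i)" and "k + r \<le> n + 1"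
  shows "\<exists>S w. chart {0..n} S w \<and> card S = k \<and> vanishes_on_chart u S w"
proof -
  define b where "b i j = Poly_Mapping.lookup (l i) (Poly_Mapping.single j 1)" for i j
  have l: "peval (l i) x = (\<Sum>j\<in>{0..n}. b i j * x j)" if "i < r" for i x
    using assms(1)[OF that] unfolding hom_form_iff b_def by (intro peval_linear) auto
  have "\<exists>S w. chart {0..n} S w \<and> card S = k \<and> (\<forall>i\<in>{..<r}. \<forall>s\<in>S. (\<Sum>j\<in>{0..n}. b i j * w s j) = 0)"
    by (rule kernel_chart) (use assms(3) in auto)
  then obtain S w where S: "chart {0..n} S w" "card S = k"
    "\<And>i s. i < r \<Longrightarrow> s \<in> S \<Longrightarrow> (\<Sum>j\<in>{0..n}. b i j * w s j) = 0"
    by blast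
  have "peval (l i) (\<lambda>j. \<Sum>s\<in>S. y s * w s j) = 0" if "i < r" for i y
  proof -
    have "peval (l i) (\<lambda>j. \<Sum>s\<in>S. y s * w s j) = (\<Sum>s\<in>S. y s * (\<Sum>j\<in>{0..n}. b i j * w s j))"
      unfolding l[OF that] by (simp add: sum_distrib_left mult_ac sum.swap[of _ S])
    then show ?thesis using S(3)[OF that] by simp
  qed
  then have "vanishes_on_chart u S w"
    by (simp add: vanishes_on_chart_def u peval_sum peval_mult)
  with S show ?thesis by blast
qed

text \<open>The coordinate \<open>j\<close> on the graph, as a linear form in the variables
  \<open>S\<close>; the differences of the variables outside \<open>S\<close> and these forms cut
  out the subspace.\<close>

definition chart_form :: "'i set \<Rightarrow> ('i \<Rightarrow> 'i \<Rightarrow> complex) \<Rightarrow> 'i \<Rightarrow> 'i cpoly" where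
  "chart_form S w j = (\<Sum>s\<in>S. Poly_Mapping.single (Poly_Mapping.single s 1) (w s j))"

lemma peval_chart_form: "peval (chart_form S w j) x = (\<Sum>s\<in>S. x s * w s j)"
  by (simp add: chart_form_def peval_sum mult.commute)

lemma keys_chart_form: "S \<subseteq> V \<Longrightarrow> Poly_Mapping.keys (chart_form S w j) \<subseteq> mons V 1"
  unfolding chart_form_def by (rule keys_sum_subset) (auto simp: mons_def)

text \<open>Writing \<open>\<phi>\<close> for the projection of \<open>x\<close> onto the graph, one
  variable is replaced at a time, as in
  \<open>a * b - a' * b' = (a - a') * b + a' * (b - b')\<close>. Only indices outside
  \<open>S\<close> occur because \<open>\<phi>\<close> fixes the coordinates in \<open>S\<close>.
  For \<open>d = 0\<close> the cofactors are required to be zero: with the truncated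
  \<open>d - 1\<close> alone, the induction step would get the degree wrong.\<close>

lemma mon_eval_diff_decomposition:
  assumes w: "chart V S w" and V: "finite V" and "\<alpha> \<in> mons V d"
  shows "\<exists>g. (\<forall>j. Poly_Mapping.keys (g j) \<subseteq> (if d = 0 then {} else mons V (d - 1))) \<and>
     (\<forall>x. mon_eval x \<alpha> - mon_eval (\<lambda>j. \<Sum>s\<in>S. x s * w s j) \<alpha> =
       (\<Sum>j\<in>V - S. (x j - (\<Sum>s\<in>S. x s * w s j)) * peval (g j) x))"
  using assms(3)
proof (induction d arbitrary: \<alpha>)
  case 0
  then have "\<alpha> = 0" by (simp add: mons_def)
  then show ?case by (intro exI[of _ "\<lambda>_. 0"]) auto
next
  case (Suc d)
  then have "\<alpha> \<noteq> 0" by (auto simp: mons_def)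
  then obtain i where i: "i \<in> Poly_Mapping.keys \<alpha>"
    by (metis in_keys_iff lookup_zero poly_mapping_eqI)
  then obtain \<beta> where \<beta>: "\<alpha> = Poly_Mapping.single i 1 + \<beta>" "Poly_Mapping.keys \<beta> \<subseteq> Poly_Mapping.keys \<alpha>"
    by (rule mon_split)
  have iV: "i \<in> V" and \<beta>d: "\<beta> \<in> mons V d"
    using i Suc.prems \<beta> by (auto simp: mons_def mon_deg_add)
  from Suc.IH[OF \<beta>d] obtain g where g: "\<And>j. Poly_Mapping.keys (g j) \<subseteq> (if d = 0 then {} else mons V (d - 1))"
    "\<And>x. mon_eval x \<beta> - mon_eval (\<lambda>j. \<Sum>s\<in>S. x s * w s j) \<beta> =
       (\<Sum>j\<in>V - S. (x j - (\<Sum>s\<in>S. x s * w s j)) * peval (g j) x)" by blast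
  have SV: "S \<subseteq> V" and finS: "finite S" using w V by (auto simp: chart_def intro: finite_subset)
  define g' where "g' j = (if j = i then Poly_Mapping.single \<beta> 1 else 0) + chart_form S w i * g j" for j
  have "Poly_Mapping.keys (chart_form S w i * g j) \<subseteq> mons V d" for j
  proof (cases "d = 0")
    case True
    then have "Poly_Mapping.keys (g j) = {}" using g(1)[of j] by simp
    then have "g j = 0" by (metis in_keys_iff empty_iff lookup_zero poly_mapping_eqI)
    then show ?thesis by simp
  next
    case False
    then have "Poly_Mapping.keys (chart_form S w i * g j) \<subseteq> mons V (1 + (d - 1))"
      using g(1)[of j] by (intro keys_mult_mons keys_chart_form SV) auto
    then show ?thesis using False by simp
  qed
  then have "Poly_Mapping.keys (g' j) \<subseteq> mons V d" for j
    unfolding g'_def using \<beta>d by (intro order.trans[OF keys_add] Un_least) auto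
  moreover have "mon_eval x \<alpha> - mon_eval (\<lambda>j. \<Sum>s\<in>S. x s * w s j) \<alpha> =
       (\<Sum>j\<in>V - S. (x j - (\<Sum>s\<in>S. x s * w s j)) * peval (g' j) x)" for x
  proof -
    define \<phi> where "\<phi> j = (\<Sum>s\<in>S. x s * w s j)" for j
    have \<phi>S: "\<phi> i = x i" if "i \<in> S" using chart_combination[OF w finS that] by (simp add: \<phi>_def)
    have "mon_eval x \<alpha> - mon_eval \<phi> \<alpha> = (x i - \<phi> i) * mon_eval x \<beta> + \<phi> i * (mon_eval x \<beta> - mon_eval \<phi> \<beta>)"
      by (simp add: \<beta> mon_eval_add algebra_simps)
    also have "(x i - \<phi> i) * mon_eval x \<beta> =
        (\<Sum>j\<in>V - S. if j = i then (x i - \<phi> i) * mon_eval x \<beta> else 0)"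
      using V iV \<phi>S by (auto simp: sum.delta)
    also have "mon_eval x \<beta> - mon_eval \<phi> \<beta> = (\<Sum>j\<in>V - S. (x j - \<phi> j) * peval (g j) x)"
      using g(2)[of x] by (simp add: \<phi>_def[abs_def])
    also have "(\<Sum>j\<in>V - S. if j = i then (x i - \<phi> i) * mon_eval x \<beta> else 0) +
        \<phi> i * (\<Sum>j\<in>V - S. (x j - \<phi> j) * peval (g j) x) =
        (\<Sum>j\<in>V - S. (x j - \<phi> j) * peval (g' j) x)"
      by (auto simp: sum_distrib_left g'_def peval_add peval_mult peval_chart_form algebra_simps
          \<phi>_def[symmetric] simp flip: sum.distrib intro!: sum.cong)
    finally show ?thesis by (simp add: \<phi>_def[abs_def])
  qed
  ultimately show ?case by (intro exI[of _ g']) auto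
qed

text \<open>Since \<open>u\<close> vanishes on the graph, it equals the difference of its values at
  \<open>x\<close> and at the projection \<open>\<phi> x\<close>. Monomial by monomial, this
  difference is a combination of the \<open>r\<close> linear forms that cut out the graph.\<close>

lemma chart_imp_decomposition:
  assumes w: "chart {0..n} S w" and u: "hom_form n d u" "vanishes_on_chart u S w" and "d \<ge> 1"
    and r: "card S + r = n + 1"
  shows "\<exists>l g. (\<forall>i<r. hom_form n 1 (l i) \<and> hom_form n (d - 1) (g i)) \<and> u = (\<Sum>i<r. l i * g i)"
proof -
  let ?V = "{0..n}"
  define \<phi> where "\<phi> x j = (\<Sum>s\<in>S. x s * w s j)" for x j
  have ku: "Poly_Mapping.keys u \<subseteq> mons ?V d" using u(1) by (simp add: hom_form_iff)
  have "\<exists>g. (\<forall>j. Poly_Mapping.keys (g j) \<subseteq> mons ?V (d - 1)) \<and>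
     (\<forall>x. mon_eval x \<alpha> - mon_eval (\<phi> x) \<alpha> = (\<Sum>j\<in>?V - S. (x j - \<phi> x j) * peval (g j) x))"
    if "\<alpha> \<in> Poly_Mapping.keys u" for \<alpha>
    using mon_eval_diff_decomposition[OF w, of \<alpha> d] that ku \<open>d \<ge> 1\<close>
    unfolding \<phi>_def by auto
  then have "\<forall>\<alpha>\<in>Poly_Mapping.keys u. \<exists>g. (\<forall>j. Poly_Mapping.keys (g j) \<subseteq> mons ?V (d - 1)) \<and>
     (\<forall>x. mon_eval x \<alpha> - mon_eval (\<phi> x) \<alpha> = (\<Sum>j\<in>?V - S. (x j - \<phi> x j) * peval (g j) x))"
    by blast
  from bchoice[OF this] obtain g where
    g: "\<And>\<alpha> j. \<alpha> \<in> Poly_Mapping.keys u \<Longrightarrow> Poly_Mapping.keys (g \<alpha> j) \<subseteq> mons ?V (d - 1)"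
     "\<And>\<alpha> x. \<alpha> \<in> Poly_Mapping.keys u \<Longrightarrow> mon_eval x \<alpha> - mon_eval (\<phi> x) \<alpha> =
       (\<Sum>j\<in>?V - S. (x j - \<phi> x j) * peval (g \<alpha> j) x)"
    by blast
  \<comment> \<open>The total cofactor of the linear form \<open>L j\<close>, collected over all
    monomials of \<open>u\<close>.\<close>
  define G where "G j = (\<Sum>\<alpha>\<in>Poly_Mapping.keys u. Poly_Mapping.single 0 (Poly_Mapping.lookup u \<alpha>) * g \<alpha> j)" for j
  define L where "L j = Poly_Mapping.single (Poly_Mapping.single j 1) 1 - chart_form S w j" for j
  have SV: "S \<subseteq> ?V" using w by (simp add: chart_def)
  have G: "hom_form n (d - 1) (G j)" for j
    unfolding hom_form_iff G_def
  proof (rule keys_sum_subset)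
    fix \<alpha> assume "\<alpha> \<in> Poly_Mapping.keys u"
    then have "Poly_Mapping.keys (Poly_Mapping.single 0 (Poly_Mapping.lookup u \<alpha>) * g \<alpha> j) \<subseteq> mons ?V (0 + (d - 1))"
      using g(1) by (intro keys_mult_mons) (auto simp: mons_def)
    then show "Poly_Mapping.keys (Poly_Mapping.single 0 (Poly_Mapping.lookup u \<alpha>) * g \<alpha> j) \<subseteq> mons ?V (d - 1)"
      by simp
  qed
  have L: "hom_form n 1 (L j)" if "j \<le> n" for j
    unfolding hom_form_iff L_def using that keys_chart_form[OF SV, of w j]
    by (intro order.trans[OF keys_diff] Un_least) (auto simp: mons_def)
  have "peval u x = peval (\<Sum>j\<in>?V - S. L j * G j) x" for x
  proof -
    have "peval u (\<phi> x) = 0" using u(2) by (simp add: vanishes_on_chart_def \<phi>_def[abs_def])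
    then have "peval u x = peval u x - peval u (\<phi> x)" by simp
    also have "\<dots> = (\<Sum>\<alpha>\<in>Poly_Mapping.keys u. Poly_Mapping.lookup u \<alpha> * (mon_eval x \<alpha> - mon_eval (\<phi> x) \<alpha>))"
      by (simp add: peval_superset[OF finite_keys order.refl] right_diff_distrib sum_subtractf)
    also have "\<dots> = (\<Sum>\<alpha>\<in>Poly_Mapping.keys u. Poly_Mapping.lookup u \<alpha> *
        (\<Sum>j\<in>?V - S. (x j - \<phi> x j) * peval (g \<alpha> j) x))"
      using g(2) by (intro sum.cong) auto
    also have "\<dots> = (\<Sum>j\<in>?V - S. (x j - \<phi> x j) * peval (G j) x)"
      by (simp add: G_def peval_sum peval_mult sum_distrib_left mult_ac sum.swap[of _ "?V - S"])
    also have "\<dots> = peval (\<Sum>j\<in>?V - S. L j * G j) x"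
      by (simp add: peval_sum peval_mult L_def peval_diff peval_chart_form \<phi>_def)
    finally show ?thesis .
  qed
  then have u_eq: "u = (\<Sum>j\<in>?V - S. L j * G j)" by (rule peval_inject)
  have "card (?V - S) = r" using r SV by (simp add: card_Diff_subset finite_subset)
  then obtain f where f: "bij_betw f {..<r} (?V - S)"
    using finite_same_card_bij[of "{..<r}" "?V - S"] by auto
  have "u = (\<Sum>i<r. L (f i) * G (f i))"
    unfolding u_eq by (rule sum.reindex_bij_betw[OF f, symmetric])
  moreover have "f i \<le> n" if "i < r" for i using f that by (auto simp: bij_betw_def)
  ultimately show ?thesis using L G by (intro exI[of _ "\<lambda>i. L (f i)"] exI[of _ "\<lambda>i. G (f i)"]) auto
qed

subsection \<open>General forms and limits\<close>

lemma lookup_scale: "Poly_Mapping.lookup (Poly_Mapping.single 0 t * p) \<alpha> = t * Poly_Mapping.lookup p \<alpha>"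
  for t :: complex
  by (simp add: Poly_Mapping.map.rep_eq when_def flip: mult_map_scale_conv_mult)

lemma peval_line:
  obtains p :: "complex poly" where "\<And>t. poly p t = peval F (\<lambda>i. a i + t * b i)"
proof
  fix t
  show "poly (\<Sum>\<alpha>\<in>Poly_Mapping.keys F. smult (Poly_Mapping.lookup F \<alpha>)
      (\<Prod>i\<in>Poly_Mapping.keys \<alpha>. [:a i, b i:] ^ Poly_Mapping.lookup \<alpha> i)) t = peval F (\<lambda>i. a i + t * b i)"
    by (simp add: peval_def poly_sum poly_prod)
qed

text \<open>Multiplication by \<open>Poly_Mapping.single 0 t\<close> is scaling by \<open>t\<close>,
  so this is the affine line through \<open>u\<close> at 0 and \<open>v\<close> at 1.\<close>

definition form_line :: "'v cpoly \<Rightarrow> 'v cpoly \<Rightarrow> complex \<Rightarrow> 'v cpoly" where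
  "form_line u v t = u + Poly_Mapping.single 0 t * (v - u)"

lemma lookup_form_line:
  "Poly_Mapping.lookup (form_line u v t) =
     (\<lambda>\<alpha>. Poly_Mapping.lookup u \<alpha> + t * (Poly_Mapping.lookup v \<alpha> - Poly_Mapping.lookup u \<alpha>))"
  by (rule ext) (simp add: form_line_def lookup_add lookup_scale lookup_minus)

lemma hom_form_line:
  assumes "hom_form n d u" "hom_form n d v"
  shows "hom_form n d (form_line u v t)"
  unfolding hom_form_iff
proof
  fix \<alpha> assume "\<alpha> \<in> Poly_Mapping.keys (form_line u v t)"
  then have "\<alpha> \<in> Poly_Mapping.keys u \<or> \<alpha> \<in> Poly_Mapping.keys v"
    by (auto simp: in_keys_iff lookup_form_line)
  then show "\<alpha> \<in> mons {0..n} d" using assms by (auto simp: hom_form_iff)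
qed

text \<open>Along a line, \<open>F\<close> becomes a one-variable polynomial, here not identically
  zero. This is how nonempty open sets of forms are handled throughout.\<close>

lemma finite_zeros_form_line:
  assumes "peval F (Poly_Mapping.lookup (form_line u v s)) \<noteq> 0"
  shows "finite {t. peval F (Poly_Mapping.lookup (form_line u v t)) = 0}"
proof -
  obtain p where p: "\<And>t. poly p t = peval F (Poly_Mapping.lookup (form_line u v t))"
    unfolding lookup_form_line
    using peval_line[of F "Poly_Mapping.lookup u" "\<lambda>\<alpha>. Poly_Mapping.lookup v \<alpha> - Poly_Mapping.lookup u \<alpha>"]
    by blast
  with assms have "p \<noteq> 0" by (metis poly_0)
  then show ?thesis unfolding p[symmetric] by (rule poly_roots_finite)
qed

lemma form_line_0 [simp]: "form_line u v 0 = u"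
  by (simp add: form_line_def)

lemma form_line_1 [simp]: "form_line u v 1 = v"
  by (simp add: form_line_def single_one)

lemma general_form_mono:
  assumes "general_form n d P" "\<And>u. hom_form n d u \<Longrightarrow> P u \<Longrightarrow> Q u"
  shows "general_form n d Q"
  using assms unfolding general_form_def by blast

lemma general_form_True: "general_form n d (\<lambda>_. True)"
  unfolding general_form_def by (intro exI[of _ 1]) (auto simp: hom_form_def intro!: exI[of _ 0])

text \<open>Two nonempty basic open sets meet: on the line joining a point of each, either condition
  excludes only finitely many parameters.\<close>

lemma general_form_conj:
  assumes "general_form n d P" "general_form n d Q"
  shows "general_form n d (\<lambda>u. P u \<and> Q u)"
proof -
  from assms(1) obtain F u where F: "hom_form n d u" "peval F (Poly_Mapping.lookup u) \<noteq> 0"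
    "\<And>u. hom_form n d u \<Longrightarrow> peval F (Poly_Mapping.lookup u) \<noteq> 0 \<Longrightarrow> P u"
    unfolding general_form_def by blast
  from assms(2) obtain G v where G: "hom_form n d v" "peval G (Poly_Mapping.lookup v) \<noteq> 0"
    "\<And>u. hom_form n d u \<Longrightarrow> peval G (Poly_Mapping.lookup u) \<noteq> 0 \<Longrightarrow> Q u"
    unfolding general_form_def by blast
  have "finite ({t. peval F (Poly_Mapping.lookup (form_line u v t)) = 0} \<union>
     {t. peval G (Poly_Mapping.lookup (form_line u v t)) = 0})"
    using F(2) G(2) finite_zeros_form_line[of F u v 0] finite_zeros_form_line[of G u v 1] by simp
  then obtain t where "peval F (Poly_Mapping.lookup (form_line u v t)) \<noteq> 0"
    "peval G (Poly_Mapping.lookup (form_line u v t)) \<noteq> 0"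
    using ex_new_if_finite[OF infinite_UNIV_char_0] by blast
  with hom_form_line[OF F(1) G(1)] F(3) G(3) show ?thesis
    unfolding general_form_def by (intro exI[of _ "F * G"]) (auto simp: peval_mult)
qed

lemma general_form_ball:
  assumes "finite I" "\<And>i. i \<in> I \<Longrightarrow> general_form n d (P i)"
  shows "general_form n d (\<lambda>u. \<forall>i\<in>I. P i u)"
  using assms
proof (induction I rule: finite_induct)
  case (insert i I)
  then have "general_form n d (\<lambda>u. P i u \<and> (\<forall>i\<in>I. P i u))" by (intro general_form_conj) auto
  then show ?case by simp
qed (simp add: general_form_True)

section \<open>Compactness and limits of subspaces\<close>

lemma tendsto_peval:
  assumes "\<And>i. ((\<lambda>k. x k i) \<longlongrightarrow> y i) F"
  shows "((\<lambda>k. peval p (x k)) \<longlongrightarrow> peval p y) F"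
  unfolding peval_def by (intro tendsto_intros assms)

text \<open>Bolzano-Weierstrass for one index after another, passing to a further subsequence each
  time.\<close>

lemma common_convergent_subseq:
  fixes f :: "nat \<Rightarrow> 'i \<Rightarrow> complex"
  assumes "finite I" "\<And>k i. i \<in> I \<Longrightarrow> norm (f k i) \<le> B"
  shows "\<exists>r l. strict_mono (r :: nat \<Rightarrow> nat) \<and> (\<forall>i\<in>I. (\<lambda>k. f (r k) i) \<longlonglongrightarrow> l i)"
  using assms
proof (induction I rule: finite_induct)
  case empty
  show ?case by (intro exI[of _ id]) (auto simp: strict_mono_def)
next
  case (insert i I)
  then have "\<exists>r l. strict_mono (r :: nat \<Rightarrow> nat) \<and> (\<forall>i\<in>I. (\<lambda>k. f (r k) i) \<longlonglongrightarrow> l i)"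
    by auto
  then obtain r l where r: "strict_mono (r :: nat \<Rightarrow> nat)" "\<And>i. i \<in> I \<Longrightarrow> (\<lambda>k. f (r k) i) \<longlonglongrightarrow> l i"
    by blast
  have "\<forall>k. f (r k) i \<in> cball 0 B" using insert.prems by simp
  then obtain a r' where r': "strict_mono (r' :: nat \<Rightarrow> nat)" "((\<lambda>k. f (r k) i) \<circ> r') \<longlonglongrightarrow> a"
    using compact_cball[of "0::complex" B] unfolding compact_def by metis
  have "(\<lambda>k. f ((r \<circ> r') k) i') \<longlonglongrightarrow> (l(i := a)) i'" if "i' \<in> insert i I" for i'
  proof (cases "i' = i")
    case True
    then show ?thesis using r'(2) by (simp add: o_def)
  next
    case False
    then show ?thesis
      using LIMSEQ_subseq_LIMSEQ[OF r(2)[of i'] r'(1)] that by (simp add: o_def)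
  qed
  then show ?case using strict_mono_o[OF r(1) r'(1)] by blast
qed

text \<open>Containing a linear subspace of dimension \<open>e\<close> is a closed condition: it is preserved under
  limits along lines in the space of forms because the bounded charts form a compact set.\<close>

lemma contains_linear_of_general:
  assumes "general_form n d (\<lambda>u. contains_linear n u e)" and u: "hom_form n d u"
  shows "contains_linear n u e"
proof -
  from assms(1) obtain F v where F: "hom_form n d v" "peval F (Poly_Mapping.lookup v) \<noteq> 0"
    "\<And>u. hom_form n d u \<Longrightarrow> peval F (Poly_Mapping.lookup u) \<noteq> 0 \<Longrightarrow> contains_linear n u e"
    unfolding general_form_def by blast
  define Z where "Z = {t. peval F (Poly_Mapping.lookup (form_line u v t)) = 0}"
  have finZ: "finite Z"
    unfolding Z_def using F(2) by (intro finite_zeros_form_line[where s = 1]) simp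
  \<comment> \<open>Distinct parameters tending to 0, the parameter of \<open>u\<close>; all but
    finitely many avoid \<open>Z\<close>, where \<open>F\<close> gives no information.\<close>
  define \<tau> where "\<tau> k = inverse (of_nat (Suc k) :: complex)" for k
  have \<tau>0: "\<tau> \<longlonglongrightarrow> 0" unfolding \<tau>_def by (rule LIMSEQ_Suc[OF lim_inverse_n])
  have "inj \<tau>" by (auto simp: inj_def \<tau>_def simp del: of_nat_Suc)
  then have "finite (\<tau> -` Z)" using finZ by (intro finite_vimageI)
  then have "infinite (- (\<tau> -` Z))" using finite_compl by blast
  define X where "X k = {(S, w). chart {0..n} S w \<and> card S = Suc e \<and>
     (\<forall>s\<in>S. \<forall>j. norm (w s j) \<le> 2 ^ Suc e) \<and> vanishes_on_chart (form_line u v (\<tau> k)) S w}" for k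
  have X: "\<exists>S w. (S, w) \<in> X k" if "k \<in> - (\<tau> -` Z)" for k
    using contains_linear_imp_chart[OF F(3)[OF hom_form_line[OF u F(1)]], of "\<tau> k"] that
    by (auto simp: Z_def X_def)
  have "\<forall>k\<in>- (\<tau> -` Z). \<exists>S\<in>Pow {0..n}. \<exists>w. (S, w) \<in> X k"
  proof
    fix k assume "k \<in> - (\<tau> -` Z)"
    then obtain S w where "(S, w) \<in> X k" using X by blast
    moreover from this have "S \<in> Pow {0..n}" by (simp add: X_def chart_def)
    ultimately show "\<exists>S\<in>Pow {0..n}. \<exists>w. (S, w) \<in> X k" by blast
  qed
  \<comment> \<open>There are finitely many coordinate sets, so a single \<open>S\<close> occurs
    infinitely often; \<open>r0\<close> enumerates those indices.\<close>
  from pigeonhole_infinite_rel[OF \<open>infinite (- (\<tau> -` Z))\<close> _ this]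
  obtain S where S: "infinite {k \<in> - (\<tau> -` Z). \<exists>w. (S, w) \<in> X k}" by auto
  define r0 where "r0 = enumerate {k \<in> - (\<tau> -` Z). \<exists>w. (S, w) \<in> X k}"
  have r0: "strict_mono r0" unfolding r0_def by (rule strict_mono_enumerate[OF S])
  have "\<exists>w. (S, w) \<in> X (r0 k)" for k
    using enumerate_in_set[OF S, of k] by (simp add: r0_def)
  then obtain w where w: "\<And>k. (S, w k) \<in> X (r0 k)" by metis
  then have wS: "\<And>k. chart {0..n} S (w k)" "card S = Suc e"
    "\<And>k s j. s \<in> S \<Longrightarrow> norm (w k s j) \<le> 2 ^ Suc e"
    "\<And>k. vanishes_on_chart (form_line u v (\<tau> (r0 k))) S (w k)"
    by (auto simp: X_def)
  have SV: "S \<subseteq> {0..n}" using wS(1) by (auto simp: chart_def)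
  then have finS: "finite S" by (rule finite_subset) simp
  have "\<exists>r l. strict_mono (r :: nat \<Rightarrow> nat) \<and>
     (\<forall>i\<in>S \<times> {0..n}. (\<lambda>k. case i of (s, j) \<Rightarrow> w (r k) s j) \<longlonglongrightarrow> l i)"
    by (rule common_convergent_subseq[of _ "\<lambda>k (s, j). w k s j"]) (use finS wS(3) in auto)
  then obtain r l where r: "strict_mono (r :: nat \<Rightarrow> nat)"
    and l: "\<forall>i\<in>S \<times> {0..n}. (\<lambda>k. case i of (s, j) \<Rightarrow> w (r k) s j) \<longlonglongrightarrow> l i"
    by blast
  \<comment> \<open>The limit chart; coordinates beyond \<open>n\<close> are 0 in every chart of the
    sequence.\<close>
  define W where "W s j = (if j \<le> n then l (s, j) else 0)" for s j
  have W: "(\<lambda>k. w (r k) s j) \<longlonglongrightarrow> W s j" if "s \<in> S" for s j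
    using bspec[OF l, of "(s, j)"] wS(1) that by (cases "j \<le> n") (auto simp: W_def chart_def)
  have "W s t = (if s = t then 1 else 0)" if "s \<in> S" "t \<in> S" for s t
  proof -
    have "(\<lambda>k. w (r k) s t) = (\<lambda>k. if s = t then 1 else 0)"
      using wS(1) that by (auto simp: chart_def fun_eq_iff)
    then show ?thesis using W[OF that(1), of t] by (simp add: LIMSEQ_const_iff)
  qed
  then have chartW: "chart {0..n} S W" using SV by (auto simp: chart_def W_def)
  have "peval u (\<lambda>j. \<Sum>s\<in>S. y s * W s j) = 0" for y
  proof -
    define x where "x k j = (\<Sum>s\<in>S. y s * w (r k) s j)" for k j
    have x: "(\<lambda>k. x k j) \<longlonglongrightarrow> (\<Sum>s\<in>S. y s * W s j)" for j
      unfolding x_def by (intro tendsto_intros W)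
    have "strict_mono (r0 \<circ> r)" using strict_mono_o[OF r0 r] .
    from LIMSEQ_subseq_LIMSEQ[OF \<tau>0 this]
    have "(\<lambda>k. - (\<tau> (r0 (r k)) * peval (v - u) (x k))) \<longlonglongrightarrow>
        - (0 * peval (v - u) (\<lambda>j. \<Sum>s\<in>S. y s * W s j))"
      by (intro tendsto_intros tendsto_peval x) (simp add: o_def)
    \<comment> \<open>The form on the line vanishes at \<open>x k\<close>, so the value of
      \<open>u\<close> there is only the perturbation term, which tends to 0.\<close>
    moreover have "- (\<tau> (r0 (r k)) * peval (v - u) (x k)) = peval u (x k)" for k
    proof -
      have "peval (form_line u v (\<tau> (r0 (r k)))) (x k) = 0"
        using wS(4)[of "r k"] by (simp add: vanishes_on_chart_def x_def[abs_def])
      then show ?thesis by (simp add: form_line_def peval_add peval_mult add_eq_0_iff)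
    qed
    ultimately have "(\<lambda>k. peval u (x k)) \<longlonglongrightarrow> 0" by simp
    moreover have "(\<lambda>k. peval u (x k)) \<longlonglongrightarrow> peval u (\<lambda>j. \<Sum>s\<in>S. y s * W s j)"
      by (intro tendsto_peval x)
    ultimately show ?thesis by (metis LIMSEQ_unique)
  qed
  then have "vanishes_on_chart u S W" by (simp add: vanishes_on_chart_def)
  from chart_imp_contains_linear[OF chartW wS(2) this] show ?thesis .
qed

subsection \<open>Algebraic dependence\<close>

text \<open>The products of the \<open>q \<alpha>\<close> with exponents at most \<open>D\<close>
  number \<open>(D + 1) ^ card A\<close>, while their expansions involve at most
  \<open>(D' + 1) ^ card K\<close> monomials, with \<open>D'\<close> linear in \<open>D\<close>. For
  large \<open>D\<close> linear algebra yields a relation.\<close>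

lemma algebraic_dependence:
  fixes q :: "'a \<Rightarrow> 'k cpoly"
  assumes A: "finite A" and K: "finite K" and less: "card K < card A"
    and q: "\<And>\<alpha>. \<alpha> \<in> A \<Longrightarrow> Poly_Mapping.keys (q \<alpha>) \<subseteq> bmons K E"
  obtains F :: "'a cpoly" where "F \<noteq> 0" "\<And>e. e \<in> Poly_Mapping.keys F \<Longrightarrow> Poly_Mapping.keys e \<subseteq> A"
    "\<And>z. peval F (\<lambda>\<alpha>. peval (q \<alpha>) z) = 0"
proof -
  \<comment> \<open>Chosen so that \<open>D' + 1 \<le> C * (D + 1)\<close>; with
    \<open>D = C ^ card K\<close> the constant factor is then absorbed by one further power of
    \<open>D + 1\<close>.\<close>
  define C where "C = card A * E + 1"
  define D where "D = C ^ card K"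
  define D' where "D' = card A * (D * E)"
  define Q where "Q e = (\<Prod>\<alpha>\<in>A. q \<alpha> ^ Poly_Mapping.lookup e \<alpha>)" for e
  have Q: "Poly_Mapping.keys (Q e) \<subseteq> bmons K D'" if "e \<in> bmons A D" for e
    unfolding Q_def D'_def
  proof (rule keys_prod_bmons[OF A])
    fix \<alpha> assume "\<alpha> \<in> A"
    have "Poly_Mapping.lookup e \<alpha> * E \<le> D * E" using that by (simp add: bmons_def)
    with keys_power_bmons[OF q[OF \<open>\<alpha> \<in> A\<close>], of "Poly_Mapping.lookup e \<alpha>"]
    show "Poly_Mapping.keys (q \<alpha> ^ Poly_Mapping.lookup e \<alpha>) \<subseteq> bmons K (D * E)"
      using bmons_mono by blast
  qed
  have "(D' + 1) ^ card K \<le> (C * (D + 1)) ^ card K"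
    by (rule power_mono) (simp_all add: C_def D'_def algebra_simps)
  also have "\<dots> = D * (D + 1) ^ card K" by (simp only: power_mult_distrib D_def)
  also have "\<dots> < (D + 1) ^ Suc (card K)" by simp
  also have "\<dots> \<le> (D + 1) ^ card A" using less by (intro power_increasing) auto
  finally have "1 + card (bmons K D') \<le> card (bmons A D)" using A K by (simp add: card_bmons)
  \<comment> \<open>The unknowns are the coefficients of \<open>F\<close>, with one equation for
    each monomial \<open>\<gamma>\<close>. A chart with one row is a solution with an entry 1, hence
    nonzero.\<close>
  from kernel_chart[OF finite_bmons[OF K] finite_bmons[OF A] this, of "\<lambda>\<gamma> e. Poly_Mapping.lookup (Q e) \<gamma>"]
  obtain S w where S: "chart (bmons A D) S w" "card S = 1"
    "\<forall>\<gamma>\<in>bmons K D'. \<forall>s\<in>S. (\<Sum>e\<in>bmons A D. Poly_Mapping.lookup (Q e) \<gamma> * w s e) = 0" by blast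
  obtain s where s: "S = {s}" using S(2) by (auto simp: card_1_singleton_iff)
  define F where "F = (\<Sum>e\<in>bmons A D. Poly_Mapping.single e (w s e))"
  have lF: "Poly_Mapping.lookup F e = (if e \<in> bmons A D then w s e else 0)" for e
    by (simp add: F_def lookup_sum lookup_single when_def finite_bmons[OF A])
  have sS: "s \<in> bmons A D" "w s s = 1" using S(1) s by (auto simp: chart_def)
  show ?thesis
  proof
    show "F \<noteq> 0" using lF[of s] sS by auto
    show "Poly_Mapping.keys e \<subseteq> A" if "e \<in> Poly_Mapping.keys F" for e
      using that by (auto simp: in_keys_iff lF bmons_def split: if_splits)
    show "peval F (\<lambda>\<alpha>. peval (q \<alpha>) z) = 0" for z
    proof -
      have "peval F (\<lambda>\<alpha>. peval (q \<alpha>) z) = (\<Sum>e\<in>bmons A D. w s e * mon_eval (\<lambda>\<alpha>. peval (q \<alpha>) z) e)"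
        by (simp add: F_def peval_sum)
      also have "\<dots> = (\<Sum>e\<in>bmons A D. w s e * peval (Q e) z)"
        using A by (intro sum.cong refl)
          (simp add: Q_def peval_prod peval_power mon_eval_superset[of A] bmons_def)
      also have "\<dots> = (\<Sum>e\<in>bmons A D. w s e * (\<Sum>\<gamma>\<in>bmons K D'. Poly_Mapping.lookup (Q e) \<gamma> * mon_eval z \<gamma>))"
        using Q finite_bmons[OF K] by (intro sum.cong refl) (simp add: peval_superset)
      also have "\<dots> = (\<Sum>\<gamma>\<in>bmons K D'. (\<Sum>e\<in>bmons A D. Poly_Mapping.lookup (Q e) \<gamma> * w s e) * mon_eval z \<gamma>)"
        unfolding sum_distrib_left sum_distrib_right
        by (subst sum.swap) (simp add: mult_ac)
      also have "\<dots> = 0" using S(3) s by simp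
      finally show ?thesis .
    qed
  qed
qed

text \<open>Expanding a monomial after a linear substitution gives coefficients polynomial in the
  parameters \<open>z\<close>, with exponents at most \<open>d\<close> since each of the
  \<open>d\<close> factors contributes at most 1.\<close>

lemma mon_eval_linear_subst:
  fixes c :: "'i \<Rightarrow> 'i \<Rightarrow> 'k cpoly"
  assumes "finite S" and c: "\<And>i s. i \<in> V \<Longrightarrow> s \<in> S \<Longrightarrow> Poly_Mapping.keys (c i s) \<subseteq> bmons K 1"
    and "\<beta> \<in> mons V d"
  shows "\<exists>P. (\<forall>\<gamma>. Poly_Mapping.keys (P \<gamma>) \<subseteq> bmons K d) \<and>
     (\<forall>z x. mon_eval (\<lambda>i. \<Sum>s\<in>S. peval (c i s) z * x s) \<beta> = (\<Sum>\<gamma>\<in>mons S d. peval (P \<gamma>) z * mon_eval x \<gamma>))"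
  using assms(3)
proof (induction d arbitrary: \<beta>)
  case 0
  have m0: "mons S 0 = {0}" by (auto simp: mons_def)
  from 0 have "\<beta> = 0" by (simp add: mons_def)
  then show ?case by (intro exI[of _ "\<lambda>_. 1"]) (simp add: m0 bmons_def)
next
  case (Suc d)
  then have "\<beta> \<noteq> 0" by (auto simp: mons_def)
  then obtain i where i: "i \<in> Poly_Mapping.keys \<beta>"
    by (metis in_keys_iff lookup_zero poly_mapping_eqI)
  then obtain \<beta>' where \<beta>': "\<beta> = Poly_Mapping.single i 1 + \<beta>'" "Poly_Mapping.keys \<beta>' \<subseteq> Poly_Mapping.keys \<beta>"
    by (rule mon_split)
  have iV: "i \<in> V" and "\<beta>' \<in> mons V d"
    using i Suc.prems \<beta>' by (auto simp: mons_def mon_deg_add)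
  from Suc.IH[OF this(2)] obtain P where P: "\<And>\<gamma>. Poly_Mapping.keys (P \<gamma>) \<subseteq> bmons K d"
    "\<And>z x. mon_eval (\<lambda>i. \<Sum>s\<in>S. peval (c i s) z * x s) \<beta>' = (\<Sum>\<gamma>\<in>mons S d. peval (P \<gamma>) z * mon_eval x \<gamma>)"
    by blast
  define h where "h = (\<lambda>(s :: 'i, \<gamma>). Poly_Mapping.single s (1::nat) + \<gamma>)"
  have h: "h ` (S \<times> mons S d) \<subseteq> mons S (Suc d)"
  proof safe
    fix s \<gamma> assume "s \<in> S" "\<gamma> \<in> mons S d"
    then have "Poly_Mapping.single s 1 + \<gamma> \<in> mons S (1 + d)"
      by (intro mons_add) (auto simp: mons_def)
    then show "h (s, \<gamma>) \<in> mons S (Suc d)" by (simp add: h_def)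
  qed
  \<comment> \<open>Different pairs may give the same monomial, so the contributions over each fibre
    of \<open>h\<close> are added.\<close>
  define P' where "P' \<delta> = (\<Sum>(s, \<gamma>)\<in>{p \<in> S \<times> mons S d. h p = \<delta>}. c i s * P \<gamma>)" for \<delta>
  have "Poly_Mapping.keys (P' \<delta>) \<subseteq> bmons K (Suc d)" for \<delta>
    unfolding P'_def using keys_mult_bmons[OF c[OF iV] P(1)] by (intro keys_sum_subset) auto
  moreover have "mon_eval (\<lambda>i. \<Sum>s\<in>S. peval (c i s) z * x s) \<beta> = (\<Sum>\<gamma>\<in>mons S (Suc d). peval (P' \<gamma>) z * mon_eval x \<gamma>)" for z x
  proof -
    have "mon_eval (\<lambda>i. \<Sum>s\<in>S. peval (c i s) z * x s) \<beta> =
        (\<Sum>s\<in>S. peval (c i s) z * x s) * (\<Sum>\<gamma>\<in>mons S d. peval (P \<gamma>) z * mon_eval x \<gamma>)"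
      by (simp add: \<beta>'(1) mon_eval_add P(2))
    also have "\<dots> = (\<Sum>(s, \<gamma>)\<in>S \<times> mons S d. peval (c i s * P \<gamma>) z * mon_eval x (h (s, \<gamma>)))"
      by (simp add: sum_product sum.cartesian_product peval_mult h_def mon_eval_add mult_ac)
    also have "\<dots> = (\<Sum>\<delta>\<in>mons S (Suc d). \<Sum>(s, \<gamma>)\<in>{p \<in> S \<times> mons S d. h p = \<delta>}.
        peval (c i s * P \<gamma>) z * mon_eval x (h (s, \<gamma>)))"
      using h assms(1) by (intro sum.group[symmetric]) (auto simp: finite_mons)
    also have "\<dots> = (\<Sum>\<delta>\<in>mons S (Suc d). peval (P' \<delta>) z * mon_eval x \<delta>)"
      unfolding P'_def peval_sum sum_distrib_right
      by (intro sum.cong refl) (auto simp: case_prod_unfold)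
    finally show ?thesis .
  qed
  ultimately show ?case by (intro exI[of _ P']) blast
qed

text \<open>Forms vanishing on a graph over \<open>S\<close> are parametrised polynomially by fewer
  parameters than there are coefficients, so all of them satisfy one nontrivial equation
  \<open>F\<close>.\<close>

lemma general_form_not_vanishes_on_chart:
  assumes S: "S \<subseteq> {0..n}" and less: "(n + 1 - card S) * card S < card (mons S d)"
  shows "general_form n d (\<lambda>u. \<not> (\<exists>w. chart {0..n} S w \<and> vanishes_on_chart u S w))"
proof -
  define V where "V = {0..n}"
  define A where "A = mons V d"
  define B where "B = mons S d"
  \<comment> \<open>The parameters: \<open>Inl \<beta>\<close> is a free coefficient of the form,
    \<open>Inr (i, s)\<close> is the entry \<open>w s i\<close> for \<open>i\<close> outside
    \<open>S\<close>.\<close>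
  define K where "K = Inl ` (A - B) \<union> Inr ` ((V - S) \<times> S)"
  define var :: "(nat \<Rightarrow>\<^sub>0 nat) + nat \<times> nat \<Rightarrow> ((nat \<Rightarrow>\<^sub>0 nat) + nat \<times> nat) cpoly"
    where "var k = Poly_Mapping.single (Poly_Mapping.single k 1) 1" for k
  have pvar: "peval (var k) z = z k" for k z by (simp add: var_def)
  have kvar: "Poly_Mapping.keys (var k) \<subseteq> bmons K 1" if "k \<in> K" for k
    using that by (auto simp: var_def bmons_def lookup_single when_def)
  define c where "c i s = (if i \<in> S then if i = s then 1 else 0 else var (Inr (i, s)))" for i s
  have SV: "S \<subseteq> V" and finV: "finite V" and finS: "finite S"
    using S by (auto simp: V_def intro: finite_subset)
  have BA: "B \<subseteq> A" using SV by (auto simp: A_def B_def mons_def)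
  have finA: "finite A" and finB: "finite B" using finV finS by (simp_all add: A_def B_def finite_mons)
  have kc: "Poly_Mapping.keys (c i s) \<subseteq> bmons K 1" if "i \<in> V" "s \<in> S" for i s
    using kvar[of "Inr (i, s)"] that by (auto simp: c_def K_def bmons_def)
  have "\<forall>\<beta>\<in>A. \<exists>P. (\<forall>\<gamma>. Poly_Mapping.keys (P \<gamma>) \<subseteq> bmons K d) \<and>
     (\<forall>z x. mon_eval (\<lambda>i. \<Sum>s\<in>S. peval (c i s) z * x s) \<beta> = (\<Sum>\<gamma>\<in>B. peval (P \<gamma>) z * mon_eval x \<gamma>))"
    unfolding A_def B_def by (intro ballI mon_eval_linear_subst[OF finS kc])
  from bchoice[OF this] obtain P where
    P: "\<And>\<beta> \<gamma>. \<beta> \<in> A \<Longrightarrow> Poly_Mapping.keys (P \<beta> \<gamma>) \<subseteq> bmons K d"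
     "\<And>\<beta> z x. \<beta> \<in> A \<Longrightarrow> mon_eval (\<lambda>i. \<Sum>s\<in>S. peval (c i s) z * x s) \<beta> =
        (\<Sum>\<gamma>\<in>B. peval (P \<beta> \<gamma>) z * mon_eval x \<gamma>)" by blast
  \<comment> \<open>On the graph, a monomial of \<open>B\<close> restricts to itself, so its
    coefficient must cancel the contributions of all monomials outside \<open>B\<close>.\<close>
  define q where "q \<alpha> = (if \<alpha> \<in> B then - (\<Sum>\<beta>\<in>A - B. var (Inl \<beta>) * P \<beta> \<alpha>) else var (Inl \<alpha>))" for \<alpha>
  have "Poly_Mapping.keys (q \<alpha>) \<subseteq> bmons K (1 + d)" if "\<alpha> \<in> A" for \<alpha>
  proof (cases "\<alpha> \<in> B")
    case True
    have "Poly_Mapping.keys (\<Sum>\<beta>\<in>A - B. var (Inl \<beta>) * P \<beta> \<alpha>) \<subseteq> bmons K (1 + d)"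
      by (intro keys_sum_subset keys_mult_bmons kvar P(1)) (auto simp: K_def)
    then show ?thesis using True by (simp add: q_def)
  next
    case False
    then have "Poly_Mapping.keys (q \<alpha>) \<subseteq> bmons K 1"
      using kvar[of "Inl \<alpha>"] that by (simp add: q_def K_def)
    then show ?thesis using bmons_mono[of 1 "1 + d" K] by simp
  qed
  moreover have "finite K" using finA finV finS by (simp add: K_def)
  moreover have "card K < card A"
  proof -
    have "card (V - S) = n + 1 - card S" using SV finS by (simp add: card_Diff_subset V_def)
    have "card K = card (A - B) + card ((V - S) \<times> S)"
      unfolding K_def using finA finV finS
      by (subst card_Un_disjoint) (auto simp: card_image)
    also have "\<dots> = card A - card B + (n + 1 - card S) * card S"
      using BA finB \<open>card (V - S) = _\<close> by (simp add: card_Diff_subset card_cartesian_product)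
    also have "\<dots> < card A"
      using less card_mono[OF finA BA] by (simp add: B_def)
    finally show ?thesis .
  qed
  ultimately obtain F where F: "F \<noteq> 0" "\<And>e. e \<in> Poly_Mapping.keys F \<Longrightarrow> Poly_Mapping.keys e \<subseteq> A"
    "\<And>z. peval F (\<lambda>\<alpha>. peval (q \<alpha>) z) = 0"
    using algebraic_dependence[OF finA, of K q "1 + d"] by blast
  obtain x where x: "peval F x \<noteq> 0" using peval_nonvanishing[OF F(1)] by blast
  \<comment> \<open>A point where \<open>F\<close> is nonzero becomes a form; only its values on
    \<open>A\<close> matter, as \<open>F\<close> involves no other variables.\<close>
  define u0 where "u0 = (\<Sum>\<alpha>\<in>A. Poly_Mapping.single \<alpha> (x \<alpha>))"
  have "hom_form n d u0"
    unfolding hom_form_iff u0_def A_def V_def by (rule keys_sum_subset) auto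
  moreover have "peval F (Poly_Mapping.lookup u0) = peval F x"
    using F(2) finA by (intro peval_cong) (auto simp: u0_def lookup_sum lookup_single when_def)
  moreover have "peval F (Poly_Mapping.lookup u) = 0"
    if u: "hom_form n d u" and w: "chart {0..n} S w" "vanishes_on_chart u S w" for u w
  proof -
    have ku: "Poly_Mapping.keys u \<subseteq> A" using u by (simp add: hom_form_iff A_def V_def)
    define z where "z k = (case k of Inl \<alpha> \<Rightarrow> Poly_Mapping.lookup u \<alpha> | Inr (i, s) \<Rightarrow> w s i)" for k
    define \<phi> where "\<phi> x i = (\<Sum>s\<in>S. peval (c i s) z * x s)" for x i
    have \<phi>: "\<phi> x i = (\<Sum>s\<in>S. x s * w s i)" for x i
      unfolding \<phi>_def using w(1) by (intro sum.cong refl) (auto simp: c_def pvar z_def chart_def)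
    have \<phi>S: "\<phi> x i = x i" if "i \<in> S" for x i
      unfolding \<phi> by (rule chart_combination[OF w(1) finS that])
    \<comment> \<open>The restriction of \<open>u\<close> to the graph, as a polynomial in the
      variables \<open>S\<close>. It vanishes identically, and its coefficients give the equations
      that define \<open>q\<close>.\<close>
    define h where "h = (\<Sum>\<gamma>\<in>B. Poly_Mapping.single \<gamma>
        (Poly_Mapping.lookup u \<gamma> + (\<Sum>\<beta>\<in>A - B. Poly_Mapping.lookup u \<beta> * peval (P \<beta> \<gamma>) z)))"
    have "peval h x = peval 0 x" for x
    proof -
      have "0 = peval u (\<phi> x)"
        using w(2) by (simp add: vanishes_on_chart_def \<phi>[abs_def])
      also have "\<dots> = (\<Sum>\<beta>\<in>B. Poly_Mapping.lookup u \<beta> * mon_eval (\<phi> x) \<beta>) +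
          (\<Sum>\<beta>\<in>A - B. Poly_Mapping.lookup u \<beta> * mon_eval (\<phi> x) \<beta>)"
        unfolding peval_superset[OF finA ku] using sum.subset_diff[OF BA finA] by (simp add: add.commute)
      also have "(\<Sum>\<beta>\<in>B. Poly_Mapping.lookup u \<beta> * mon_eval (\<phi> x) \<beta>) =
          (\<Sum>\<beta>\<in>B. Poly_Mapping.lookup u \<beta> * mon_eval x \<beta>)"
        using \<phi>S by (intro sum.cong refl arg_cong2[of _ _ _ _ "(*)"] mon_eval_cong)
          (auto simp: B_def mons_def)
      also have "(\<Sum>\<beta>\<in>A - B. Poly_Mapping.lookup u \<beta> * mon_eval (\<phi> x) \<beta>) =
          (\<Sum>\<beta>\<in>A - B. Poly_Mapping.lookup u \<beta> * (\<Sum>\<gamma>\<in>B. peval (P \<beta> \<gamma>) z * mon_eval x \<gamma>))"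
        using P(2)[of _ z x] by (intro sum.cong refl) (simp add: \<phi>_def[abs_def])
      also have "\<dots> = (\<Sum>\<gamma>\<in>B. (\<Sum>\<beta>\<in>A - B. Poly_Mapping.lookup u \<beta> * peval (P \<beta> \<gamma>) z) * mon_eval x \<gamma>)"
        unfolding sum_distrib_left sum_distrib_right
        by (subst sum.swap) (simp add: mult_ac)
      finally show ?thesis
        by (simp add: h_def peval_sum distrib_right sum.distrib)
    qed
    then have "h = 0" by (rule peval_inject)
    have "Poly_Mapping.lookup u \<alpha> = peval (q \<alpha>) z" if "\<alpha> \<in> A" for \<alpha>
    proof (cases "\<alpha> \<in> B")
      case True
      then have "Poly_Mapping.lookup h \<alpha> =
          Poly_Mapping.lookup u \<alpha> + (\<Sum>\<beta>\<in>A - B. Poly_Mapping.lookup u \<beta> * peval (P \<beta> \<alpha>) z)"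
        using finB by (simp add: h_def lookup_sum lookup_single when_def)
      then have "Poly_Mapping.lookup u \<alpha> = - (\<Sum>\<beta>\<in>A - B. Poly_Mapping.lookup u \<beta> * peval (P \<beta> \<alpha>) z)"
        using \<open>h = 0\<close> by (simp add: add_eq_0_iff2)
      also have "\<dots> = peval (q \<alpha>) z"
        using True by (simp add: q_def peval_uminus peval_sum peval_mult pvar z_def)
      finally show ?thesis .
    next
      case False
      then show ?thesis by (simp add: q_def pvar z_def)
    qed
    then have "peval F (Poly_Mapping.lookup u) = peval F (\<lambda>\<alpha>. peval (q \<alpha>) z)"
      using F(2) by (intro peval_cong) auto
    with F(3) show ?thesis by simp
  qed
  ultimately show ?thesis unfolding general_form_def using x by (intro exI[of _ F]) metis
qed

subsection \<open>Strength\<close>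

lemma R_strength_le:
  assumes "\<forall>i<r. hom_form n 1 (l i) \<and> hom_form n (d - 1) (g i)" "u = (\<Sum>i<r. l i * g i)"
  shows "R_strength n d u \<le> enat r"
  unfolding R_strength_def using assms by (intro Inf_lower) blast

lemma R_strength_lessE:
  assumes "R_strength n d u < enat k"
  obtains r l g where "r < k" "\<And>i. i < r \<Longrightarrow> hom_form n 1 (l i)" "u = (\<Sum>i<r. l i * g i)"
proof -
  from assms obtain r l g where "r < k" "\<forall>i<r. hom_form n 1 (l i) \<and> hom_form n (d - 1) (g i)"
    "u = (\<Sum>i<r. l i * g i)"
    unfolding R_strength_def Inf_less_iff mem_Collect_eq by (elim bexE exE conjE CollectE) simp
  then show thesis by (intro that) auto
qed

lemma contains_linear_imp_R_strength_le:
  assumes "contains_linear n u e" "hom_form n d u" "d \<ge> 1"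
  shows "R_strength n d u \<le> enat (n - e)"
proof -
  from contains_linear_imp_chart[OF assms(1)] obtain S w where
    S: "chart {0..n} S w" "card S = Suc e" "vanishes_on_chart u S w" by blast
  \<comment> \<open>This gives \<open>e \<le> n\<close>, so the subtraction \<open>n - e\<close> is
    not truncated.\<close>
  then have "Suc e \<le> n + 1" using card_mono[of "{0..n}" S] by (simp add: chart_def)
  then have "card S + (n - e) = n + 1" using S(2) by simp
  from chart_imp_decomposition[OF S(1) assms(2) S(3) assms(3) this] show ?thesis
    using R_strength_le by blast
qed

text \<open>A decomposition of length \<open>r < n - e\<close> would produce a subspace of dimension
  \<open>n - r > e\<close>, against maximality.\<close>

lemma max_linear_dim_imp_R_strength:
  assumes "max_linear_dim n u e" "hom_form n d u" "d \<ge> 1"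
  shows "R_strength n d u = enat (n - e)"
proof (rule antisym)
  show "R_strength n d u \<le> enat (n - e)"
    using assms by (intro contains_linear_imp_R_strength_le) (auto simp: max_linear_dim_def)
  show "enat (n - e) \<le> R_strength n d u"
  proof (rule ccontr)
    assume "\<not> enat (n - e) \<le> R_strength n d u"
    then have "R_strength n d u < enat (n - e)" by simp
    then obtain r l g where r: "r < n - e" "\<And>i. i < r \<Longrightarrow> hom_form n 1 (l i)" "u = (\<Sum>i<r. l i * g i)"
      by (rule R_strength_lessE) blast
    have "Suc (n - r) + r \<le> n + 1" using r(1) by simp
    from decomposition_imp_chart[OF r(2,3) this] obtain S w where
      "chart {0..n} S w" "card S = Suc (n - r)" "vanishes_on_chart u S w" by blast
    then have "contains_linear n u (n - r)" by (rule chart_imp_contains_linear)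
    then show False using assms(1) r(1) by (simp add: max_linear_dim_def)
  qed
qed

text \<open>A shorter decomposition yields an \<open>m\<close>-dimensional subspace that is a graph
  over one of finitely many sets \<open>S\<close>; each is excluded by an open condition. For
  \<open>m > n\<close> the bound is 0.\<close>

lemma general_form_R_strength_ge:
  assumes "(int n - int m) * (int m + 1) < int ((m + d) choose m)"
  shows "general_form n d (\<lambda>u. R_strength n d u \<ge> enat (nat (int n - int m + 1)))"
proof (rule general_form_mono)
  let ?I = "{S. S \<subseteq> {0..n} \<and> card S = m + 1}"
  show "general_form n d (\<lambda>u. \<forall>S\<in>?I. \<not> (\<exists>w. chart {0..n} S w \<and> vanishes_on_chart u S w))"
  proof (intro general_form_ball general_form_not_vanishes_on_chart)
    fix S assume S: "S \<in> ?I"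
    then have "finite S" by (auto intro: finite_subset)
    then have "card (mons S d) = (m + d) choose m"
      using S binomial_symmetric[of m "m + d"] by (simp add: card_mons)
    \<comment> \<open>Once some \<open>S\<close> exists, natural and integer subtraction
      agree.\<close>
    moreover have "m \<le> n" using S card_mono[of "{0..n}" S] by simp
    then have "int ((n - m) * (m + 1)) = (int n - int m) * (int m + 1)"
      by (simp only: of_nat_mult of_nat_diff of_nat_add of_nat_1)
    ultimately show "(n + 1 - card S) * card S < card (mons S d)"
      using assms S by (simp only: mem_Collect_eq flip: of_nat_less_iff[where 'a = int]) simp
  qed auto
next
  fix u assume *: "\<forall>S\<in>{S. S \<subseteq> {0..n} \<and> card S = m + 1}. \<not> (\<exists>w. chart {0..n} S w \<and> vanishes_on_chart u S w)"
  show "R_strength n d u \<ge> enat (nat (int n - int m + 1))"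
  proof (rule ccontr)
    assume "\<not> ?thesis"
    then have "R_strength n d u < enat (nat (int n - int m + 1))" by simp
    then obtain r l g where r: "r < nat (int n - int m + 1)"
      "\<And>i. i < r \<Longrightarrow> hom_form n 1 (l i)" "u = (\<Sum>i<r. l i * g i)"
      by (rule R_strength_lessE) blast
    have "(m + 1) + r \<le> n + 1" using r(1) by linarith
    from decomposition_imp_chart[OF r(2,3) this] obtain S w where
      S: "chart {0..n} S w" "card S = m + 1" "vanishes_on_chart u S w" by blast
    moreover from S(1) have "S \<subseteq> {0..n}" by (simp add: chart_def)
    ultimately show False using * by blast
  qed
qed

theorem theorem5p5:
  fixes n d :: nat
  assumes "n \<ge> 1" and "d \<ge> 2"
  shows "(\<forall>m::nat. m \<ge> 1 \<longrightarrow> (int n - int m) * (int m + 1) < int ((m + d) choose m) \<longrightarrow> d \<ge> 4 \<longrightarrow>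
            general_form n d (\<lambda>u. R_strength n d u \<ge> enat (nat (int n - int m + 1))))
       \<and> (\<forall>e::nat. general_form n d (\<lambda>u. max_linear_dim n u e) \<longrightarrow>
            ((\<forall>u. hom_form n d u \<and> u \<noteq> 0 \<longrightarrow> R_strength n d u \<le> enat (n - e))
             \<and> general_form n d (\<lambda>u. R_strength n d u = enat (n - e))))"
proof (intro conjI allI impI)
  fix m :: nat
  assume "(int n - int m) * (int m + 1) < int ((m + d) choose m)"
  then show "general_form n d (\<lambda>u. R_strength n d u \<ge> enat (nat (int n - int m + 1)))"
    by (rule general_form_R_strength_ge)
next
  fix e u
  assume "general_form n d (\<lambda>u. max_linear_dim n u e)" and u: "hom_form n d u \<and> u \<noteq> 0"
  \<comment> \<open>Unlike maximality, containment is closed, so it passes from general forms to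
    every form.\<close>
  then have "general_form n d (\<lambda>u. contains_linear n u e)"
    by (elim general_form_mono) (simp add: max_linear_dim_def)
  with u assms(2) show "R_strength n d u \<le> enat (n - e)"
    by (intro contains_linear_imp_R_strength_le contains_linear_of_general) auto
next
  fix e
  assume "general_form n d (\<lambda>u. max_linear_dim n u e)"
  then show "general_form n d (\<lambda>u. R_strength n d u = enat (n - e))"
    using assms(2) by (elim general_form_mono max_linear_dim_imp_R_strength) auto
qed

end
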